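(* Let $m$ be a positive integer, let $\lambda$ be a partition of $n\in\mathbb{N}_0$ and let $b=\lfloor n/m\rfloor$. (i) For each integer $1\le j\le b$, \[\sum_{1\le i_1<\cdots<i_j\le b}|P_{i_1}\cap\cdots\cap P_{i_j}|=\sum_{A\in W_j(\lambda)}c_A.\] (ii) $d_\lambda=\varepsilon_\lambda c^{(m)}_\lambda$.
   Context: $\mathbb{N}$ denotes the positive integers and $\mathbb{N}_0$ the non-negative integers. Compositions and partitions. A composition of $n\in\mathbb{N}_0$ is a finite sequence $\lambda=(\lambda_1,\ldots,\lambda_r)$ of positive integers with sum $n$; write $|\lambda|=n$, $\ell(\lambda)=r$; the unique composition of $0$ is $\varnothing$. It is a partition if $\lambda_1\ge\cdots\ge\lambda_r$. A composition $\delta$ has type $\lambda$ if its parts can be rearranged to the partition $\lambda$. For compositions $\delta,\xi$, $\delta\cup\xi$ is the partition obtained by rearranging the concatenation of $\delta$ and $\xi$; similarly for several compositions. $m\mu=(m\mu_1,m\mu_2,\ldots)$. Combinatorial notation. $\mathscr{C}(\lambda)$ is the set of compositions of type $\lambda$ and $c_\lambda=|\mathscr{C}(\lambda)|$. $c^{(m)}_\lambda$ is the number of $\delta=(\delta_1,\ldots,\delta_{\ell(\lambda)})\in\mathscr{C}(\lambda)$ such that $\delta_1+\cdots+\delta_j\not\equiv0\pmod m$ for all $1\le j\le\ell(\lambda)$. $\varepsilon_\lambda=(-1)^{|\lambda|-\ell(\lambda)}$. Conventions: $c_\varnothing=c^{(m)}_\varnothing=\varepsilon_\varnothing=1$. $W(\lambda)$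 is the set of sequences $(\delta^{(1)},\ldots,\delta^{(r)},\xi)$ of partitions, $r\in\mathbb{N}_0$ ($r$ may be zero), such that $\xi\cup\delta^{(1)}\cup\cdots\cup\delta^{(r)}=\lambda$, and $\delta^{(i)}\ne\varnothing$ and $m\mid|\delta^{(i)}|$ for all $1\le i\le r$ ($\xi$ may be $\varnothing$). For $1\le i\le b$, $W_i(\lambda)$ is the subset of $W(\lambda)$ of sequences of length $i+1$ (i.e. with $r=i$). For a sequence $A=(\nu^{(1)},\ldots,\nu^{(t)})$ of partitions, $c_A=\prod_{i=1}^tc_{\nu^{(i)}}$. For $1\le i\le b$, $P_i$ is the set of $(\mu_1,\ldots,\mu_{\ell(\lambda)})\in\mathscr{C}(\lambda)$ such that $\mu_1+\cdots+\mu_r=mi$ for some $1\le r\le\ell(\lambda)$. The ring $\Gamma^{(m)}$ and the integers $d_\lambda$. Let $X=\{x_i:i\in\mathbb{N}\}$, $Y=\{y_j:j\in\mathbb{N}\}$ be independent countably infinite sets of commuting variables, $\Lambda(X),\Lambda(Y)$ the rings of symmetric functions over $\mathbb{Z}$, $h_n(X)$ the complete symmetric functions in $X$ and $e_n(Y)$ the elementary symmetric functions in $Y$ ($h_0(X)=1=e_0(Y)$). Let $\langle\Lambda(X),\Lambda(Y)\rangle$ be the subring of the power series ring in $X\cup Y$ generated by $\Lambda(X)$ and $\Lambda(Y)$, and $\Gamma^{(m)}=\langle\Lambda(X),\Lambda(Y)\rangle/I$, where $I$ is the ideal generated by $\sum_{i=0}^d(-1)^ih_i(X)e_{d-i}(Y)$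 for all positive integers $d$ with $m\nmid d$. Write $h_i,e_j$ for the images of $h_i(X),e_j(Y)$, $h_\alpha=\prod_ih_{\alpha_i}$, $e_\beta=\prod_je_{\beta_j}$. It is known (Donkin) that $\{h_\lambda e_{m\mu}:\lambda,\mu\text{ partitions}\}$ is a $\mathbb{Z}$-basis of $\Gamma^{(m)}$. For each $n\in\mathbb{N}_0$, $e_n$ is a $\mathbb{Z}$-linear combination $e_n=\sum d_{n,\mu}h_\mu e_{sm}$ over partitions $\mu$ and $s\in\mathbb{N}_0$ with $|\mu|+sm=n$, and $d_{n,\mu}$ denotes the coefficient. For fixed $\mu$ the number $d_{|\mu|+rm,\mu}$ is independent of $r\in\mathbb{N}_0$; $d_\mu$ denotes this common value. So $d_\lambda$ is the coefficient of $h_\lambda$ in $e_{|\lambda|}$. *)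

theory Defs
  imports
    "HOL-Library.Multiset"
    "HOL-Combinatorics.Permutations"
    "HOL-Number_Theory.Cong"
    "HOL-Algebra.Generated_Rings"
    "HOL-Algebra.QuotRing"
begin

section \<open>Compositions and partitions\<close>

text \<open>A composition is the list of its parts; \<open>sum_list\<close> is its size and \<open>length\<close> its
  number of parts.\<close>

definition is_composition :: "nat list \<Rightarrow> bool" where
  "is_composition \<delta> \<longleftrightarrow> (\<forall>p\<in>set \<delta>. 0 < p)"

definition is_partition :: "nat list \<Rightarrow> bool" where
  "is_partition \<mu> \<longleftrightarrow> is_composition \<mu> \<and> sorted_wrt (\<ge>) \<mu>"

text \<open>The union of a list of compositions: all parts together, in weakly decreasing order.\<close>

definition part_union :: "nat list list \<Rightarrow> nat list" where
  "part_union \<delta>s = rev (sort (concat \<delta>s))"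

definition comps_of_type :: "nat list \<Rightarrow> nat list set" where
  "comps_of_type \<mu> = {\<delta>. is_composition \<delta> \<and> mset \<delta> = mset \<mu>}"

definition c_num :: "nat list \<Rightarrow> nat" where
  "c_num \<mu> = card (comps_of_type \<mu>)"

definition cm_num :: "nat \<Rightarrow> nat list \<Rightarrow> nat" where
  "cm_num m \<mu> =
     card {\<delta> \<in> comps_of_type \<mu>. \<forall>j\<in>{1..length \<mu>}. \<not> [sum_list (take j \<delta>) = 0] (mod m)}"

text \<open>The subtraction below never truncates on compositions, whose parts are positive.\<close>

definition eps :: "nat list \<Rightarrow> int" where
  "eps \<mu> = (- 1) ^ (sum_list \<mu> - length \<mu>)"

text \<open>A sequence \<open>(\<delta>\<^sup>1, \<dots>, \<delta>\<^sup>r, \<xi>)\<close> is encoded as the list \<open>\<delta>s @ [\<xi>]\<close>.\<close>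

definition W :: "nat \<Rightarrow> nat list \<Rightarrow> nat list list set" where
  "W m \<mu> = {\<delta>s @ [\<xi>] | \<delta>s \<xi>.
     (\<forall>\<delta>\<in>set \<delta>s. is_partition \<delta> \<and> \<delta> \<noteq> [] \<and> m dvd sum_list \<delta>) \<and>
     is_partition \<xi> \<and> part_union (\<xi> # \<delta>s) = \<mu>}"

definition W_len :: "nat \<Rightarrow> nat \<Rightarrow> nat list \<Rightarrow> nat list list set" where
  "W_len m i \<mu> = {A \<in> W m \<mu>. length A = i + 1}"

definition c_seq :: "nat list list \<Rightarrow> nat" where
  "c_seq A = (\<Prod>\<nu>\<leftarrow>A. c_num \<nu>)"

definition P_set :: "nat \<Rightarrow> nat list \<Rightarrow> nat \<Rightarrow> nat list set" where
  "P_set m \<mu> i =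
     {\<delta> \<in> comps_of_type \<mu>. \<exists>r. 1 \<le> r \<and> r \<le> length \<mu> \<and> sum_list (take r \<delta>) = m * i}"


section \<open>Power series in infinitely many variables\<close>

text \<open>A monomial in variables from \<open>'v\<close> is a finite multiset of variables, and a formal power
  series over the integers is its coefficient function.\<close>

type_synonym 'v pseries = "'v multiset \<Rightarrow> int"

definition pseries_ring :: "'v pseries ring" where
  "pseries_ring =
     \<lparr>carrier = UNIV,
      mult = (\<lambda>f g M. \<Sum>(A, B) | A + B = M. f A * g B),
      one = (\<lambda>M. if M = {#} then 1 else 0),
      zero = (\<lambda>M. 0),
      add = (\<lambda>f g M. f M + g M)\<rparr>"

text \<open>Symmetric functions in the set \<open>V\<close> of variables: series of bounded degree involving only
  variables from \<open>V\<close> and invariant under all permutations of \<open>V\<close>.\<close>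

definition symfuns :: "'v set \<Rightarrow> 'v pseries set" where
  "symfuns V = {f.
     (\<forall>M. f M \<noteq> 0 \<longrightarrow> set_mset M \<subseteq> V) \<and>
     (\<exists>d. \<forall>M. f M \<noteq> 0 \<longrightarrow> size M \<le> d) \<and>
     (\<forall>\<pi>. \<pi> permutes V \<longrightarrow> (\<forall>M. f (image_mset \<pi> M) = f M))}"

text \<open>The complete symmetric function is the sum of all monomials of degree \<open>n\<close>, the elementary
  one the sum of those that are squarefree.\<close>

definition complete_sym :: "'v set \<Rightarrow> nat \<Rightarrow> 'v pseries" where
  "complete_sym V n = (\<lambda>M. of_bool (set_mset M \<subseteq> V \<and> size M = n))"

definition elem_sym :: "'v set \<Rightarrow> nat \<Rightarrow> 'v pseries" where
  "elem_sym V n = (\<lambda>M. of_bool (set_mset M \<subseteq> V \<and> size M = n \<and> (\<forall>v. count M v \<le> 1)))"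


section \<open>The ring \<open>\<Gamma>\<close>\<close>

text \<open>The variables \<open>x\<close> are \<open>Inl 0, Inl 1, \<dots>\<close> and the variables \<open>y\<close> are
  \<open>Inr 0, Inr 1, \<dots>\<close>.\<close>

type_synonym var = "nat + nat"

definition Xvars :: "var set" where "Xvars = range Inl"

definition Yvars :: "var set" where "Yvars = range Inr"

definition sym_XY :: "var pseries ring" where
  "sym_XY = pseries_ring
     \<lparr>carrier := generate_ring pseries_ring (symfuns Xvars \<union> symfuns Yvars)\<rparr>"

definition Gamma_rel :: "nat \<Rightarrow> var pseries" where
  "Gamma_rel d = (\<Oplus>\<^bsub>sym_XY\<^esub>i\<in>{0..d}.
     [((- 1 :: int) ^ i)] \<cdot>\<^bsub>sym_XY\<^esub> (complete_sym Xvars i \<otimes>\<^bsub>sym_XY\<^esub> elem_sym Yvars (d - i)))"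

definition Gamma_ideal :: "nat \<Rightarrow> var pseries set" where
  "Gamma_ideal m = Idl\<^bsub>sym_XY\<^esub> {Gamma_rel d | d. 0 < d \<and> \<not> m dvd d}"

definition Gamma :: "nat \<Rightarrow> var pseries set ring" where
  "Gamma m = sym_XY Quot Gamma_ideal m"

definition h_img :: "nat \<Rightarrow> nat \<Rightarrow> var pseries set" where
  "h_img m i = Gamma_ideal m +>\<^bsub>sym_XY\<^esub> complete_sym Xvars i"

definition e_img :: "nat \<Rightarrow> nat \<Rightarrow> var pseries set" where
  "e_img m j = Gamma_ideal m +>\<^bsub>sym_XY\<^esub> elem_sym Yvars j"

definition h_prod :: "nat \<Rightarrow> nat list \<Rightarrow> var pseries set" where
  "h_prod m \<alpha> = (\<Otimes>\<^bsub>Gamma m\<^esub>k\<in>{..<length \<alpha>}. h_img m (\<alpha> ! k))"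


section \<open>The integers \<open>d\<close>\<close>

definition exp_index :: "nat \<Rightarrow> nat \<Rightarrow> (nat list \<times> nat) set" where
  "exp_index m n = {(\<mu>, s). is_partition \<mu> \<and> sum_list \<mu> + s * m = n}"

text \<open>\<open>e_coeffs m n \<mu>\<close> is the coefficient of \<open>h\<^sub>\<mu> e\<^sub>s\<^sub>m\<close> in \<open>e\<^sub>n\<close>, where \<open>s\<close> is determined by
  \<open>|\<mu>| + s m = n\<close>; it is \<open>0\<close> if there is no such \<open>s\<close>. The expansion is unique because the
  elements \<open>h\<^sub>\<mu> e\<^sub>s\<^sub>m\<close> are part of Donkin's basis of \<open>\<Gamma>\<close>.\<close>

definition e_coeffs :: "nat \<Rightarrow> nat \<Rightarrow> nat list \<Rightarrow> int" where
  "e_coeffs m n = (THE d.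
     (\<forall>\<mu>. \<mu> \<notin> fst ` exp_index m n \<longrightarrow> d \<mu> = 0) \<and>
     e_img m n = (\<Oplus>\<^bsub>Gamma m\<^esub>p\<in>exp_index m n.
        [d (fst p)] \<cdot>\<^bsub>Gamma m\<^esub>
          (h_prod m (fst p) \<otimes>\<^bsub>Gamma m\<^esub> e_img m (snd p * m))))"

text \<open>The common value of the coefficients of \<open>h\<^sub>\<mu> e\<^sub>r\<^sub>m\<close> in \<open>e\<^sub>|\<^sub>\<mu>\<^sub>|\<^sub>+\<^sub>r\<^sub>m\<close> for all \<open>r\<close>.\<close>

definition d_num :: "nat \<Rightarrow> nat list \<Rightarrow> int" where
  "d_num m \<mu> = (THE d. \<forall>r. e_coeffs m (sum_list \<mu> + r * m) \<mu> = d)"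

end

theory Submission
  imports
    Defs
    "HOL-Algebra.Divisibility"
    "HOL-Computational_Algebra.Polynomial_FPS"
    "HOL-Computational_Algebra.Fundamental_Theorem_Algebra"
begin

text \<open>(i) Both sides count the ways to cut a composition of type \<open>\<lambda>\<close> into \<open>j\<close> nonempty blocks of size
  divisible by \<open>m\<close> followed by an arbitrary rest: if \<open>g\<close> partial sums of the composition are
  divisible by \<open>m\<close>, there are \<open>g\<close> choose \<open>j\<close> ways.

  (ii) If \<open>m\<close> does not divide \<open>n\<close>, the defining relation of \<open>\<Gamma>\<close> in degree \<open>n\<close> expresses \<open>e\<^sub>n\<close> by the
  products \<open>h\<^sub>i e\<^sub>n\<^sub>-\<^sub>i\<close> with \<open>i \<ge> 1\<close>. Iterating until the index of \<open>e\<close> is divisible by \<open>m\<close> gives a signed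
  sum of \<open>h\<^sub>\<delta> e\<^sub>s\<^sub>m\<close> over the compositions \<open>\<delta>\<close> no nonempty suffix of which has sum divisible by \<open>m\<close>;
  reversing \<open>\<delta>\<close> yields the compositions counted by \<open>c\<^sup>m\<close>. The coefficients are unique because
  finitely many of the variables can be specialised to complex numbers such that all relations
  hold, \<open>e\<^sub>s\<^sub>m\<close> becomes \<open>1\<close> and \<open>h\<^sub>1, \<dots>, h\<^sub>n\<close> take prescribed values; for the values
  \<open>h\<^sub>i = T ^ ((n + 1) ^ i)\<close> distinct \<open>h\<^sub>\<mu>\<close> become distinct powers of \<open>T\<close>.\<close>

section \<open>Cutting compositions into blocks\<close>

text \<open>A weakly decreasing list is determined by its multiset of entries, so equality of
  partitions reduces to equality of multisets.\<close>

lemma rev_sort_eq_iff: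
  assumes "is_partition \<nu>"
  shows "rev (sort \<gamma>) = \<nu> \<longleftrightarrow> mset \<gamma> = mset \<nu>"
proof
  assume "rev (sort \<gamma>) = \<nu>"
  then have "mset (rev (sort \<gamma>)) = mset \<nu>" by simp
  then show "mset \<gamma> = mset \<nu>" by simp
next
  assume eq: "mset \<gamma> = mset \<nu>"
  have "sorted (rev \<nu>)"
    using assms by (simp add: is_partition_def sorted_wrt_rev)
  then have "sort \<gamma> = rev \<nu>"
    using eq by (intro properties_for_sort) simp_all
  then show "rev (sort \<gamma>) = \<nu>" by simp
qed

lemma is_partition_rev_sort: "is_composition \<gamma> \<Longrightarrow> is_partition (rev (sort \<gamma>))"
  by (simp add: is_partition_def is_composition_def sorted_wrt_rev)

lemma part_union_eq_iff:
  "is_partition \<nu> \<Longrightarrow> part_union \<delta>s = \<nu> \<longleftrightarrow> mset (concat \<delta>s) = mset \<nu>"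
  by (simp add: part_union_def rev_sort_eq_iff)

lemma is_composition_mset_cong: "mset \<gamma> = mset \<delta> \<Longrightarrow> is_composition \<gamma> \<longleftrightarrow> is_composition \<delta>"
  by (metis is_composition_def set_mset_mset)

lemma finite_comps_of_type [simp]: "finite (comps_of_type \<mu>)"
proof -
  have "comps_of_type \<mu> \<subseteq> {\<delta>. set \<delta> \<subseteq> set \<mu> \<and> length \<delta> = length \<mu>}"
    unfolding comps_of_type_def by (auto dest: mset_eq_setD mset_eq_length)
  moreover have "finite {\<delta>. set \<delta> \<subseteq> set \<mu> \<and> length \<delta> = length \<mu>}"
    by (rule finite_lists_length_eq) simp
  ultimately show ?thesis by (rule finite_subset)
qed

text \<open>The entries of \<open>A\<close> are rearranged independently of each other. These
  choices are the fibre over \<open>A\<close> when blocks are sorted below.\<close>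

lemma card_list_all2_comps: "card {Cs. list_all2 (\<lambda>\<gamma> \<nu>. \<gamma> \<in> comps_of_type \<nu>) Cs A} = c_seq A"
proof (induction A)
  case Nil
  then show ?case by (simp add: c_seq_def)
next
  case (Cons \<nu> A)
  let ?L = "\<lambda>A. {Cs. list_all2 (\<lambda>\<gamma> \<nu>. \<gamma> \<in> comps_of_type \<nu>) Cs A}"
  have "?L (\<nu> # A) = (\<lambda>(\<gamma>, Cs). \<gamma> # Cs) ` (comps_of_type \<nu> \<times> ?L A)"
    by (auto simp: list_all2_Cons2 image_iff)
  moreover have "inj_on (\<lambda>(\<gamma>, Cs). \<gamma> # Cs) (comps_of_type \<nu> \<times> ?L A)"
    by (auto simp: inj_on_def)
  ultimately have "card (?L (\<nu> # A)) = card (comps_of_type \<nu> \<times> ?L A)"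
    by (simp add: card_image)
  also have "\<dots> = c_seq (\<nu> # A)"
    using Cons.IH by (simp add: c_seq_def c_num_def card_cartesian_product)
  finally show ?case .
qed

text \<open>The encoding is that of \<open>W\<close>, with the rest \<xi> as last entry, so that
  sorting each block of a cutting gives an element of \<open>W_len\<close>.\<close>

definition blocks :: "nat \<Rightarrow> nat \<Rightarrow> nat list \<Rightarrow> nat list list set" where
  "blocks m j \<delta> = {\<gamma>s @ [\<xi>] | \<gamma>s \<xi>. length \<gamma>s = j \<and>
     (\<forall>\<gamma>\<in>set \<gamma>s. \<gamma> \<noteq> [] \<and> m dvd sum_list \<gamma>) \<and> concat \<gamma>s @ \<xi> = \<delta>}"

lemma blocksI:
  "\<lbrakk>A = \<gamma>s @ [\<xi>]; length \<gamma>s = j; \<And>\<gamma>. \<gamma> \<in> set \<gamma>s \<Longrightarrow> \<gamma> \<noteq> [] \<and> m dvd sum_list \<gamma>; concat \<gamma>s @ \<xi> = \<delta>\<rbrakk>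
    \<Longrightarrow> A \<in> blocks m j \<delta>"
  unfolding blocks_def by blast

lemma dvd_sum_list_concat:
  fixes m :: nat
  shows "(\<And>\<gamma>. \<gamma> \<in> set \<gamma>s \<Longrightarrow> m dvd sum_list \<gamma>) \<Longrightarrow> m dvd sum_list (concat \<gamma>s)"
  by (induction \<gamma>s) auto

lemma blocks_Nil: "blocks m j [] = (if j = 0 then {[[]]} else {})"
proof -
  have "\<gamma>s = []" if "concat \<gamma>s = []" "\<forall>\<gamma>\<in>set \<gamma>s. \<gamma> \<noteq> [] \<and> m dvd sum_list \<gamma>" for \<gamma>s
    using that by (cases \<gamma>s) auto
  then have "blocks m j [] = {\<gamma>s @ [\<xi>] | \<gamma>s \<xi>. length \<gamma>s = j \<and> \<gamma>s = [] \<and> \<xi> = []}"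
    unfolding blocks_def by (intro Collect_cong) (metis append_is_Nil_conv concat.simps(1) empty_iff empty_set)
  then show ?thesis by auto
qed

text \<open>If the last block is empty, the last part lies in the block before it, and the block
  sums are all divisible by \<open>m\<close> exactly when the sum of the other blocks and the total sum are.\<close>

lemma blocks_snoc:
  "blocks m j (\<delta> @ [x]) =
     (\<lambda>A. butlast A @ [last A @ [x]]) ` blocks m j \<delta> \<union>
     (if 0 < j \<and> m dvd sum_list (\<delta> @ [x])
      then (\<lambda>A. butlast A @ [last A @ [x], []]) ` blocks m (j - 1) \<delta> else {})"
  (is "?L = ?f ` _ \<union> (if ?c then ?g ` _ else {})")
proof (intro equalityI subsetI)
  fix A assume "A \<in> ?L"
  then obtain \<gamma>s \<xi> where A: "A = \<gamma>s @ [\<xi>]" "length \<gamma>s = j"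
    "\<And>\<gamma>. \<gamma> \<in> set \<gamma>s \<Longrightarrow> \<gamma> \<noteq> [] \<and> m dvd sum_list \<gamma>" "concat \<gamma>s @ \<xi> = \<delta> @ [x]"
    unfolding blocks_def by blast
  show "A \<in> ?f ` blocks m j \<delta> \<union> (if ?c then ?g ` blocks m (j - 1) \<delta> else {})"
  proof (cases \<xi> rule: rev_cases)
    case (snoc ys y)
    then have "\<gamma>s @ [ys] \<in> blocks m j \<delta>" using A by (intro blocksI[of _ \<gamma>s ys]) auto
    moreover have "A = ?f (\<gamma>s @ [ys])" using A snoc by simp
    ultimately show ?thesis by blast
  next
    case Nil
    with A(4) obtain gs g where gs: "\<gamma>s = gs @ [g]" by (cases \<gamma>s rule: rev_cases) auto
    moreover from this A(3) obtain ys y where g: "g = ys @ [y]" by (cases g rule: rev_cases) auto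
    ultimately have "y = x" and \<delta>: "\<delta> = concat gs @ ys" using A(4) Nil by auto
    then have "gs @ [ys] \<in> blocks m (j - 1) \<delta>" using A gs by (intro blocksI[of _ gs ys]) auto
    then have "?g (gs @ [ys]) \<in> ?g ` blocks m (j - 1) \<delta>" by (rule imageI)
    moreover have "A = ?g (gs @ [ys])" using A Nil gs g \<open>y = x\<close> by simp
    moreover have "m dvd sum_list (concat \<gamma>s)" using A(3) by (intro dvd_sum_list_concat) auto
    then have ?c using A(2,4) gs Nil by (simp del: sum_list_append sum_list.append)
    ultimately show ?thesis by (simp only: if_True simp_thms) blast
  qed
next
  fix A assume "A \<in> ?f ` blocks m j \<delta> \<union> (if ?c then ?g ` blocks m (j - 1) \<delta> else {})"
  then consider B where "B \<in> blocks m j \<delta>" "A = ?f B"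
    | B where "B \<in> blocks m (j - 1) \<delta>" "?c" "A = ?g B" by (auto split: if_splits)
  then show "A \<in> ?L"
  proof cases
    case 1
    then obtain \<gamma>s \<xi> where B: "B = \<gamma>s @ [\<xi>]" "length \<gamma>s = j"
      "\<And>\<gamma>. \<gamma> \<in> set \<gamma>s \<Longrightarrow> \<gamma> \<noteq> [] \<and> m dvd sum_list \<gamma>" "concat \<gamma>s @ \<xi> = \<delta>"
      unfolding blocks_def by blast
    then show ?thesis using 1 by (intro blocksI[of _ \<gamma>s "\<xi> @ [x]"]) auto
  next
    case 2
    then obtain \<gamma>s \<xi> where B: "B = \<gamma>s @ [\<xi>]" "length \<gamma>s = j - 1"
      "\<And>\<gamma>. \<gamma> \<in> set \<gamma>s \<Longrightarrow> \<gamma> \<noteq> [] \<and> m dvd sum_list \<gamma>" "concat \<gamma>s @ \<xi> = \<delta>"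
      unfolding blocks_def by blast
    have "m dvd sum_list (concat \<gamma>s)" using B(3) by (intro dvd_sum_list_concat) auto
    moreover have "m dvd sum_list (concat \<gamma>s) + sum_list (\<xi> @ [x])" using 2 B(4) by (auto simp: add.assoc)
    ultimately have "m dvd sum_list (\<xi> @ [x])" by (metis dvd_add_right_iff)
    then show ?thesis using 2 B by (intro blocksI[of _ "\<gamma>s @ [\<xi> @ [x]]" "[]"]) auto
  qed
qed

text \<open>A cutting amounts to a choice of \<open>j\<close> ends of blocks among the positions
  whose partial sum is divisible by \<open>m\<close>. The induction appends one part at a time,
  where \<open>blocks_snoc\<close> becomes Pascal's rule.\<close>

lemma card_blocks:
  "finite (blocks m j \<delta>) \<and>
   card (blocks m j \<delta>) = card {r \<in> {1..length \<delta>}. m dvd sum_list (take r \<delta>)} choose j"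
proof (induction \<delta> arbitrary: j rule: rev_induct)
  case Nil
  then show ?case by (cases j) (auto simp: blocks_Nil)
next
  case (snoc x \<delta>)
  let ?f = "\<lambda>A. butlast A @ [last A @ [x]]"
  let ?g = "\<lambda>A. butlast A @ [last A @ [x], []]"
  let ?G = "\<lambda>\<delta>. {r \<in> {1..length \<delta>}. m dvd sum_list (take r \<delta>)}"
  have ne: "A \<noteq> []" if "A \<in> blocks m i \<delta>" for A i
    using that by (auto simp: blocks_def)
  have eq: "A = B" if "butlast A = butlast B" "last A = last B" "A \<noteq> []" "B \<noteq> []" for A B :: "nat list list"
    using that by (metis append_butlast_last_id)
  have inj: "inj_on ?f (blocks m i \<delta>)" "inj_on ?g (blocks m i \<delta>)" for i
    by (simp_all add: inj_on_def eq ne)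
  \<comment> \<open>The last entry is nonempty after \<open>?f\<close> and empty after
    \<open>?g\<close>.\<close>
  have disj: "?f ` blocks m i \<delta> \<inter> ?g ` blocks m k \<delta> = {}" for i k
    by auto
  \<comment> \<open>Appending \<open>x\<close> leaves the earlier partial sums alone and adds only
    the total sum as a new candidate.\<close>
  have G: "?G (\<delta> @ [x]) = (if m dvd sum_list (\<delta> @ [x]) then insert (Suc (length \<delta>)) (?G \<delta>) else ?G \<delta>)"
    by (auto simp: le_Suc_eq)
  have [simp]: "finite (?G \<delta>)" "Suc (length \<delta>) \<notin> ?G \<delta>" by auto
  show ?case
  proof (cases "m dvd sum_list (\<delta> @ [x]) \<and> 0 < j")
    case True
    then obtain k where k: "j = Suc k" by (cases j) auto
    have U: "blocks m j (\<delta> @ [x]) = ?f ` blocks m j \<delta> \<union> ?g ` blocks m k \<delta>"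
      using True using blocks_snoc[of m j \<delta> x] by (simp only: k) simp
    then have "card (blocks m j (\<delta> @ [x])) = card (blocks m j \<delta>) + card (blocks m k \<delta>)"
      using snoc.IH by (simp add: card_Un_disjoint disj card_image inj)
    moreover have "card (?G (\<delta> @ [x])) = Suc (card (?G \<delta>))"
      using True unfolding G by (simp del: sum_list_append)
    moreover have "finite (blocks m j (\<delta> @ [x]))"
      using snoc.IH by (simp add: U)
    ultimately show ?thesis
      using snoc.IH by (simp only: k binomial_Suc_Suc) simp
  next
    case False
    have "card (?G (\<delta> @ [x])) choose j = card (?G \<delta>) choose j"
      using False unfolding G by (cases "j = 0") (simp_all del: sum_list_append)
    moreover have "blocks m j (\<delta> @ [x]) = ?f ` blocks m j \<delta>"
      using False unfolding blocks_snoc[of m j] by (simp only: if_False simp_thms conj_commute Un_empty_right)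
    ultimately show ?thesis using snoc.IH by (simp add: card_image inj)
  qed
qed

section \<open>Partial sums divisible by m, the sets P_i and the sequences in W_j\<close>

lemma sum_list_take_strict_mono:
  assumes "is_composition \<delta>" "r < s" "s \<le> length \<delta>"
  shows "sum_list (take r \<delta>) < sum_list (take s \<delta>)"
proof -
  have "take s \<delta> = take r \<delta> @ take (s - r) (drop r \<delta>)"
    using assms by (metis le_add_diff_inverse less_imp_le take_add)
  moreover have "0 < sum_list (take (s - r) (drop r \<delta>))"
  proof -
    obtain t where "s - r = Suc t" using assms by (metis Suc_diff_Suc)
    moreover have "drop r \<delta> = \<delta> ! r # drop (Suc r) \<delta>" using assms by (simp add: Cons_nth_drop_Suc)
    moreover have "0 < \<delta> ! r" using assms by (simp add: is_composition_def)
    ultimately show ?thesis by simp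
  qed
  ultimately show ?thesis by simp
qed

text \<open>Since parts are positive, the partial sums increase strictly, so dividing them by
  \<open>m\<close> is a bijection from the positions with divisible partial sum to the indices
  \<open>i\<close> with \<delta> in P_i.\<close>

lemma card_P_set_indices:
  assumes "0 < m" "\<delta> \<in> comps_of_type \<mu>"
  shows "card {i \<in> {1..sum_list \<mu> div m}. \<delta> \<in> P_set m \<mu> i} =
    card {r \<in> {1..length \<delta>}. m dvd sum_list (take r \<delta>)}"
proof -
  let ?s = "\<lambda>r. sum_list (take r \<delta>)"
  let ?G = "{r \<in> {1..length \<delta>}. m dvd ?s r}"
  have comp: "is_composition \<delta>" and mset: "mset \<delta> = mset \<mu>"
    using assms by (auto simp: comps_of_type_def)
  have len: "length \<mu> = length \<delta>" and sum: "sum_list \<mu> = sum_list \<delta>"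
    using mset by (metis size_mset, metis sum_mset_sum_list)
  have le: "?s r \<le> sum_list \<delta>" for r
    by (metis append_take_drop_id le_add1 sum_list_append)
  have pos: "0 < ?s r" if "r \<in> ?G" for r
    using sum_list_take_strict_mono[OF comp, of 0 r] that by auto
  have inj: "inj_on (\<lambda>r. ?s r div m) ?G"
  proof (rule inj_onI)
    fix r s assume rs: "r \<in> ?G" "s \<in> ?G" "?s r div m = ?s s div m"
    then have "?s r = ?s s" by (metis (no_types, lifting) dvd_div_mult_self mem_Collect_eq)
    then show "r = s"
      using rs sum_list_take_strict_mono[OF comp, of r s] sum_list_take_strict_mono[OF comp, of s r]
      by (cases r s rule: linorder_cases) auto
  qed
  have img: "(\<lambda>r. ?s r div m) ` ?G = {i \<in> {1..sum_list \<mu> div m}. \<delta> \<in> P_set m \<mu> i}"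
  proof (intro equalityI subsetI)
    fix i assume "i \<in> (\<lambda>r. ?s r div m) ` ?G"
    then obtain r where r: "r \<in> ?G" "i = ?s r div m" by blast
    then have "m * i = ?s r" by auto
    then have "1 \<le> i" using pos[OF r(1)] by (cases "i = 0") (simp_all del: sum_list_eq_0_iff)
    then show "i \<in> {i \<in> {1..sum_list \<mu> div m}. \<delta> \<in> P_set m \<mu> i}"
      using r \<open>m * i = ?s r\<close> assms(2) le[of r]
      by (auto simp: P_set_def len sum div_le_mono)
  next
    fix i assume "i \<in> {i \<in> {1..sum_list \<mu> div m}. \<delta> \<in> P_set m \<mu> i}"
    then obtain r where "1 \<le> r" "r \<le> length \<delta>" "?s r = m * i"
      by (auto simp: P_set_def len)
    then show "i \<in> (\<lambda>r. ?s r div m) ` ?G"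
      using \<open>0 < m\<close> by (intro image_eqI[of _ _ r]) auto
  qed
  show ?thesis using card_image[OF inj] unfolding img .
qed

text \<open>Double counting of the pairs (\<delta>, S) with \<delta> in P_i for all i in S: for
  fixed \<delta>, S is any \<open>j\<close>-subset of the index set counted in
  \<open>card_P_set_indices\<close>.\<close>

lemma sum_card_Inter_P_set:
  assumes "0 < m" "0 < j"
  shows "(\<Sum>S | S \<subseteq> {1..sum_list \<mu> div m} \<and> card S = j. card (\<Inter>i\<in>S. P_set m \<mu> i)) =
    (\<Sum>\<delta>\<in>comps_of_type \<mu>. card {r \<in> {1..length \<delta>}. m dvd sum_list (take r \<delta>)} choose j)"
proof -
  let ?b = "sum_list \<mu> div m"
  let ?SS = "{S. S \<subseteq> {1..?b} \<and> card S = j}"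
  have "(\<Sum>S\<in>?SS. card (\<Inter>i\<in>S. P_set m \<mu> i)) =
    (\<Sum>S\<in>?SS. card {\<delta> \<in> comps_of_type \<mu>. \<forall>i\<in>S. \<delta> \<in> P_set m \<mu> i})"
  proof (intro sum.cong refl arg_cong[of _ _ card])
    fix S assume "S \<in> ?SS"
    \<comment> \<open>A member of \<open>S\<close> confines the intersection to
      \<open>comps_of_type\<close>; the empty intersection would be the whole type, which is why
      \<open>0 < j\<close> is assumed.\<close>
    then obtain i where "i \<in> S" using assms by fastforce
    then show "(\<Inter>i\<in>S. P_set m \<mu> i) = {\<delta> \<in> comps_of_type \<mu>. \<forall>i\<in>S. \<delta> \<in> P_set m \<mu> i}"
      by (auto simp: P_set_def)
  qed
  also have "\<dots> = (\<Sum>\<delta>\<in>comps_of_type \<mu>.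
      card {r \<in> {1..length \<delta>}. m dvd sum_list (take r \<delta>)} choose j)"
  proof (rule sum_multicount_gen)
    show "\<forall>\<delta>\<in>comps_of_type \<mu>. card {S \<in> ?SS. \<forall>i\<in>S. \<delta> \<in> P_set m \<mu> i} =
      card {r \<in> {1..length \<delta>}. m dvd sum_list (take r \<delta>)} choose j"
    proof
      fix \<delta> assume \<delta>: "\<delta> \<in> comps_of_type \<mu>"
      have "{S \<in> ?SS. \<forall>i\<in>S. \<delta> \<in> P_set m \<mu> i} =
        {S. S \<subseteq> {i \<in> {1..?b}. \<delta> \<in> P_set m \<mu> i} \<and> card S = j}" by auto
      then show "card {S \<in> ?SS. \<forall>i\<in>S. \<delta> \<in> P_set m \<mu> i} =
        card {r \<in> {1..length \<delta>}. m dvd sum_list (take r \<delta>)} choose j"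
        using card_P_set_indices[OF assms(1) \<delta>] by (simp add: n_subsets)
    qed
  qed auto
  finally show ?thesis .
qed

text \<open>Sorting every block maps the cuttings of all compositions of the given type onto
  \<open>W_len\<close>, and the fibre over \<open>A\<close> has \<open>c_seq A\<close>
  elements.\<close>

lemma sum_c_seq_W_len:
  assumes "is_partition \<mu>"
  shows "(\<Sum>A\<in>W_len m j \<mu>. c_seq A) = (\<Sum>\<delta>\<in>comps_of_type \<mu>. card (blocks m j \<delta>))"
proof -
  let ?B = "\<Union>\<delta>\<in>comps_of_type \<mu>. blocks m j \<delta>"
  let ?f = "map (\<lambda>\<gamma>::nat list. rev (sort \<gamma>))"
  have sum_sort: "sum_list (rev (sort \<gamma>)) = sum_list \<gamma>" for \<gamma> :: "nat list"
    by (metis mset_rev mset_sort sum_mset_sum_list)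
  have mset_concat: "mset (concat (?f Cs)) = mset (concat Cs)" for Cs
    by (induction Cs) auto
  have W: "?f Cs \<in> W_len m j \<mu>" if Cs: "Cs \<in> ?B" for Cs
  proof -
    from Cs obtain \<gamma>s \<xi> where B: "Cs = \<gamma>s @ [\<xi>]" "length \<gamma>s = j"
      "\<And>\<gamma>. \<gamma> \<in> set \<gamma>s \<Longrightarrow> \<gamma> \<noteq> [] \<and> m dvd sum_list \<gamma>" "concat \<gamma>s @ \<xi> \<in> comps_of_type \<mu>"
      unfolding blocks_def by blast
    have "mset (rev (sort \<xi>)) + mset (concat (?f \<gamma>s)) = mset \<mu>"
      using B(4) mset_concat[of \<gamma>s] by (simp add: comps_of_type_def add.commute)
    moreover have "is_composition \<xi>" "\<And>\<gamma>. \<gamma> \<in> set \<gamma>s \<Longrightarrow> is_composition \<gamma>"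
      using B(4) by (auto simp: comps_of_type_def is_composition_def)
    moreover have "sort \<gamma> \<noteq> []" if "\<gamma> \<in> set \<gamma>s" for \<gamma>
      using B(3)[OF that] by (metis mset_sort mset_zero_iff)
    ultimately show ?thesis
      using B assms unfolding W_len_def W_def
      by (auto simp: part_union_eq_iff is_partition_rev_sort sum_sort[simplified])
  qed
  \<comment> \<open>A sequence in \<open>W_len\<close> is itself a cutting, of its own
    concatenation, and is fixed by sorting. This gives surjectivity and finiteness of
    \<open>W_len\<close>.\<close>
  have fW: "?f A = A" "A \<in> ?B" "\<And>\<nu>. \<nu> \<in> set A \<Longrightarrow> is_partition \<nu>" if A: "A \<in> W_len m j \<mu>" for A
  proof -
    from A obtain \<delta>s \<xi> where W: "A = \<delta>s @ [\<xi>]" "length \<delta>s = j"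
      "\<And>\<delta>. \<delta> \<in> set \<delta>s \<Longrightarrow> is_partition \<delta> \<and> \<delta> \<noteq> [] \<and> m dvd sum_list \<delta>"
      "is_partition \<xi>" "part_union (\<xi> # \<delta>s) = \<mu>"
      unfolding W_len_def W_def by auto
    have "concat \<delta>s @ \<xi> \<in> comps_of_type \<mu>"
      using W assms by (auto simp: part_union_eq_iff comps_of_type_def is_partition_def is_composition_def add.commute)
    moreover have "A \<in> blocks m j (concat \<delta>s @ \<xi>)"
      using W by (intro blocksI) auto
    ultimately show "A \<in> ?B" by blast
    show part: "is_partition \<nu>" if "\<nu> \<in> set A" for \<nu> using that W by auto
    show "?f A = A" using part rev_sort_eq_iff by (intro map_idI) auto
  qed
  have fin: "finite ?B" using card_blocks by auto
  have "W_len m j \<mu> \<subseteq> ?f ` ?B"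
    using fW(1,2) by (metis (no_types, lifting) image_eqI subsetI)
  then have finW: "finite (W_len m j \<mu>)" using fin by (metis finite_imageI finite_subset)
  have "c_seq A = card {Cs \<in> ?B. ?f Cs = A}" if A: "A \<in> W_len m j \<mu>" for A
  proof -
    have iff: "\<gamma> \<in> comps_of_type \<nu> \<longleftrightarrow> rev (sort \<gamma>) = \<nu>" if "is_partition \<nu>" for \<gamma> \<nu>
      using that is_composition_mset_cong[of \<gamma> \<nu>]
      by (auto simp: comps_of_type_def rev_sort_eq_iff is_partition_def)
    have "list_all2 (\<lambda>\<gamma> \<nu>. \<gamma> \<in> comps_of_type \<nu>) Cs A \<longleftrightarrow> ?f Cs = A" for Cs
    proof -
      have "list_all2 (\<lambda>\<gamma> \<nu>. \<gamma> \<in> comps_of_type \<nu>) Cs A \<longleftrightarrow> list_all2 (\<lambda>\<gamma> \<nu>. rev (sort \<gamma>) = \<nu>) Cs A"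
        using fW(3)[OF A] iff by (intro list.rel_cong refl) auto
      then show ?thesis by (simp add: list_all2_conv_all_nth list_eq_iff_nth_eq) 
    qed
    \<comment> \<open>Sorting changes neither emptiness nor the sum of a block, so any list of lists
      that sorts to \<open>A\<close> is a cutting.\<close>
    moreover have "Cs \<in> ?B" if Cs: "?f Cs = A" for Cs
    proof -
      from A obtain \<delta>s \<xi> where W: "A = \<delta>s @ [\<xi>]" "length \<delta>s = j"
        "\<And>\<delta>. \<delta> \<in> set \<delta>s \<Longrightarrow> is_partition \<delta> \<and> \<delta> \<noteq> [] \<and> m dvd sum_list \<delta>"
        "is_partition \<xi>" "part_union (\<xi> # \<delta>s) = \<mu>"
        unfolding W_len_def W_def by auto
      from Cs W obtain \<gamma>s \<zeta> where C: "Cs = \<gamma>s @ [\<zeta>]" "?f \<gamma>s = \<delta>s" "rev (sort \<zeta>) = \<xi>"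
        by (auto simp: map_eq_append_conv)
      have "mset (concat \<gamma>s @ \<zeta>) = mset \<mu>"
        using W(5) C(2,3) mset_concat[of \<gamma>s] assms by (auto simp: part_union_eq_iff add.commute)
      then have "concat \<gamma>s @ \<zeta> \<in> comps_of_type \<mu>"
        using assms is_composition_mset_cong[of "concat \<gamma>s @ \<zeta>" \<mu>]
        by (simp add: comps_of_type_def is_partition_def)
      moreover have "Cs \<in> blocks m j (concat \<gamma>s @ \<zeta>)"
      proof (rule blocksI)
        fix \<gamma> assume "\<gamma> \<in> set \<gamma>s"
        then have "rev (sort \<gamma>) \<in> set \<delta>s" using C(2) by auto
        then show "\<gamma> \<noteq> [] \<and> m dvd sum_list \<gamma>" using W(3) sum_sort by force
      qed (use C W in auto)
      ultimately show ?thesis by blast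
    qed
    ultimately have "{Cs \<in> ?B. ?f Cs = A} = {Cs. list_all2 (\<lambda>\<gamma> \<nu>. \<gamma> \<in> comps_of_type \<nu>) Cs A}"
      by auto
    then show ?thesis by (simp add: card_list_all2_comps)
  qed
  then have "(\<Sum>A\<in>W_len m j \<mu>. c_seq A) = (\<Sum>A\<in>W_len m j \<mu>. \<Sum>Cs | Cs \<in> ?B \<and> ?f Cs = A. 1)"
    by simp
  also have "\<dots> = (\<Sum>Cs\<in>?B. 1)"
    using fin finW W by (intro sum.group) auto
  also have "\<dots> = (\<Sum>\<delta>\<in>comps_of_type \<mu>. card (blocks m j \<delta>))"
    \<comment> \<open>Cuttings of different compositions are different, because concatenation
      recovers the composition.\<close>
    using card_blocks by (simp, subst card_UN_disjoint) (auto simp: blocks_def)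
  finally show ?thesis .
qed

lemma sum_card_Inter_P_set_eq_sum_c_seq:
  assumes "0 < m" "is_partition \<mu>" "0 < j"
  shows "(\<Sum>S | S \<subseteq> {1..sum_list \<mu> div m} \<and> card S = j. card (\<Inter>i\<in>S. P_set m \<mu> i)) =
    (\<Sum>A\<in>W_len m j \<mu>. c_seq A)"
  using assms by (simp only: sum_card_Inter_P_set sum_c_seq_W_len card_blocks)

section \<open>Evaluation of power series of bounded degree\<close>

lemma finite_mset_splits [simp]: "finite {(A, B). A + B = (M::'v multiset)}"
proof -
  have "finite (\<Union>k\<le>size M. multisets_of_size (set_mset M) k)" (is "finite ?U")
    by (intro finite_UN_I) auto
  moreover have "{(A, B). A + B = M} \<subseteq> ?U \<times> ?U"
    by (auto simp: multisets_of_size_def)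
  ultimately show ?thesis by (metis finite_SigmaI finite_subset)
qed

lemma pseries_ring_simps [simp]:
  "carrier pseries_ring = UNIV"
  "mult pseries_ring f g = (\<lambda>M. \<Sum>(A, B) | A + B = M. f A * g B)"
  "one pseries_ring = (\<lambda>M. if M = {#} then 1 else 0)"
  "zero pseries_ring = (\<lambda>M. 0)"
  "add pseries_ring f g = (\<lambda>M. f M + g M)"
  by (simp_all add: pseries_ring_def)

lemma pseries_mult_assoc:
  fixes f g h :: "'v pseries"
  shows "(\<Sum>(A, B) | A + B = M. (\<Sum>(C, D) | C + D = A. f C * g D) * h B) =
    (\<Sum>(A, B) | A + B = M. f A * (\<Sum>(C, D) | C + D = B. g C * h D))"
proof -
  have "(\<Sum>(A, B) | A + B = M. (\<Sum>(C, D) | C + D = A. f C * g D) * h B) =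
    (\<Sum>p | fst p + snd p = M. \<Sum>q | fst q + snd q = fst p. f (fst q) * g (snd q) * h (snd p))"
    by (simp add: sum_distrib_right case_prod_unfold)
  also have "\<dots> = (\<Sum>(p, q)\<in>Sigma {p. fst p + snd p = M} (\<lambda>p. {q. fst q + snd q = fst p}).
     f (fst q) * g (snd q) * h (snd p))"
    using finite_mset_splits by (intro sum.Sigma) (auto simp: case_prod_unfold)
  also have "\<dots> = (\<Sum>(p, q)\<in>Sigma {p. fst p + snd p = M} (\<lambda>p. {q. fst q + snd q = snd p}).
     f (fst p) * (g (fst q) * h (snd q)))"
    \<comment> \<open>A factorisation M = C + D + B is stored as ((C + D, B), (C, D)) on the left
      and as ((C, D + B), (D, B)) on the right; the witnesses translate between the two.\<close>
    by (rule sum.reindex_bij_witness[of _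
          "\<lambda>(p, q). ((fst p + fst q, snd q), (fst p, fst q))"
          "\<lambda>(p, q). ((fst q, snd q + snd p), (snd q, snd p))"])
       (auto simp: mult.assoc add.assoc)
  also have "\<dots> = (\<Sum>p | fst p + snd p = M. \<Sum>q | fst q + snd q = snd p. f (fst p) * (g (fst q) * h (snd q)))"
    using finite_mset_splits by (intro sum.Sigma[symmetric]) (auto simp: case_prod_unfold)
  also have "\<dots> = (\<Sum>(A, B) | A + B = M. f A * (\<Sum>(C, D) | C + D = B. g C * h D))"
    by (simp add: sum_distrib_left case_prod_unfold)
  finally show ?thesis .
qed

lemma pseries_mult_commute:
  fixes f g :: "'v pseries"
  shows "(\<Sum>(A, B) | A + B = M. f A * g B) = (\<Sum>(A, B) | A + B = M. g A * f B)"
  by (rule sum.reindex_bij_witness[of _ prod.swap prod.swap]) (auto simp: add.commute)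

lemma cring_pseries_ring: "cring (pseries_ring :: 'v pseries ring)"
proof (rule cringI)
  show "abelian_group (pseries_ring :: 'v pseries ring)"
  proof (rule abelian_groupI)
    fix f :: "'v pseries"
    show "\<exists>g\<in>carrier pseries_ring. g \<oplus>\<^bsub>pseries_ring\<^esub> f = \<zero>\<^bsub>pseries_ring\<^esub>"
      by (intro bexI[of _ "\<lambda>M. - f M"]) auto
  qed auto
  show "Group.comm_monoid (pseries_ring :: 'v pseries ring)"
  proof (rule comm_monoidI)
    fix f :: "'v pseries"
    have "(\<Sum>(A, B) | A + B = M. (if A = {#} then 1 else 0) * f B) = f M" for M
    proof -
      have "(\<Sum>(A, B) | A + B = M. (if A = {#} then 1 else 0) * f B) =
        (\<Sum>(A, B)\<in>{({#} :: 'v multiset, M)}. (if A = {#} then 1 else 0) * f B)"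
        by (rule sum.mono_neutral_right) (auto split: if_splits)
      then show ?thesis by simp
    qed
    then show "\<one>\<^bsub>pseries_ring\<^esub> \<otimes>\<^bsub>pseries_ring\<^esub> f = f" by simp
  next
    fix f g h :: "'v pseries"
    show "f \<otimes>\<^bsub>pseries_ring\<^esub> g \<otimes>\<^bsub>pseries_ring\<^esub> h = f \<otimes>\<^bsub>pseries_ring\<^esub> (g \<otimes>\<^bsub>pseries_ring\<^esub> h)"
      by (simp add: pseries_mult_assoc)
    show "f \<otimes>\<^bsub>pseries_ring\<^esub> g = g \<otimes>\<^bsub>pseries_ring\<^esub> f"
      using pseries_mult_commute[of f g] by (intro ext) simp
  qed auto
qed (simp add: fun_eq_iff case_prod_unfold distrib_right sum.distrib)

interpretation pseries: cring "pseries_ring :: 'v pseries ring"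
  by (rule cring_pseries_ring)

section \<open>Symmetric functions and their values at points of finite support\<close>

lemma sym_XY_simps:
  "carrier sym_XY = generate_ring pseries_ring (symfuns Xvars \<union> symfuns Yvars)"
  "mult sym_XY = mult pseries_ring"
  "one sym_XY = one pseries_ring"
  "zero sym_XY = zero pseries_ring"
  "add sym_XY = add pseries_ring"
  by (simp_all add: sym_XY_def)

lemma cring_sym_XY: "cring sym_XY"
  using pseries.subcring_iff[of "generate_ring pseries_ring (symfuns Xvars \<union> symfuns Yvars)"]
    pseries.generate_ring_is_subring[of "symfuns Xvars \<union> symfuns Yvars"] 
  by (simp add: sym_XY_def pseries.subcringI')

lemma image_mset_permutes:
  assumes "\<pi> permutes V"
  shows "set_mset (image_mset \<pi> M) \<subseteq> V \<longleftrightarrow> set_mset M \<subseteq> V"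
  using permutes_in_image[OF assms] by auto

lemma complete_sym_in_symfuns: "complete_sym V n \<in> symfuns V"
  by (auto simp: symfuns_def complete_sym_def image_mset_permutes simp del: set_image_mset)

lemma count_image_mset_inj: "inj g \<Longrightarrow> count (image_mset g M) (g x) = count M x"
  by (induction M) (auto dest: injD)

lemma elem_sym_in_symfuns: "elem_sym V n \<in> symfuns V"
proof -
  have "(\<forall>v. count (image_mset \<pi> M) v \<le> 1) \<longleftrightarrow> (\<forall>v. count M v \<le> 1)" if "\<pi> permutes V" for \<pi> M
  proof -
    have "count (image_mset \<pi> M) (\<pi> v) = count M v" for v
      using permutes_inj[OF that] by (rule count_image_mset_inj)
    then show ?thesis
      using permutes_surj[OF that] by (metis surjD)
  qed
  then show ?thesis
    by (auto simp: symfuns_def elem_sym_def image_mset_permutes simp del: set_image_mset)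
qed

lemma complete_sym_carrier [simp]: "complete_sym Xvars n \<in> carrier sym_XY"
  by (simp add: sym_XY_simps generate_ring.incl complete_sym_in_symfuns)

lemma elem_sym_carrier [simp]: "elem_sym Yvars n \<in> carrier sym_XY"
  by (simp add: sym_XY_simps generate_ring.incl elem_sym_in_symfuns)

text \<open>A power series in general has no value at a point, since infinitely many monomials may
  contribute. Bounded degree is the property, preserved by the ring operations, that allows
  evaluation on \<open>sym_XY\<close>.\<close>

definition bdeg :: "'v pseries \<Rightarrow> nat \<Rightarrow> bool" where
  "bdeg f d \<longleftrightarrow> (\<forall>M. f M \<noteq> 0 \<longrightarrow> size M \<le> d)"

lemma bdeg_mono: "bdeg f d \<Longrightarrow> d \<le> e \<Longrightarrow> bdeg f e"
  unfolding bdeg_def by (meson le_trans)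

lemma bdeg_add: "bdeg f d \<Longrightarrow> bdeg g d \<Longrightarrow> bdeg (f \<oplus>\<^bsub>pseries_ring\<^esub> g) d"
  unfolding bdeg_def by (metis add.right_neutral pseries_ring_simps(5))

lemma bdeg_mult: "bdeg f d \<Longrightarrow> bdeg g e \<Longrightarrow> bdeg (f \<otimes>\<^bsub>pseries_ring\<^esub> g) (d + e)"
  unfolding bdeg_def
proof (intro allI impI)
  fix M assume fg: "\<forall>M. f M \<noteq> 0 \<longrightarrow> size M \<le> d" "\<forall>M. g M \<noteq> 0 \<longrightarrow> size M \<le> e"
    and "(f \<otimes>\<^bsub>pseries_ring\<^esub> g) M \<noteq> 0"
  then have "(\<Sum>(A, B) | A + B = M. f A * g B) \<noteq> 0" by simp
  then obtain p where "p \<in> {(A, B). A + B = M}" "(case p of (A, B) \<Rightarrow> f A * g B) \<noteq> 0"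
    by (rule sum.not_neutral_contains_not_neutral)
  then obtain A B where AB: "A + B = M" "f A \<noteq> 0" "g B \<noteq> 0" by auto
  then have "size A \<le> d" "size B \<le> e" using fg by blast+
  then show "size M \<le> d + e" using AB(1) by (metis add_mono size_union)
qed

lemma pseries_a_inv: "\<ominus>\<^bsub>pseries_ring\<^esub> f = (\<lambda>M. - f M)"
  by (rule pseries.minus_equality) auto

lemma bdeg_carrier: "f \<in> carrier sym_XY \<Longrightarrow> \<exists>d. bdeg f d"
  unfolding sym_XY_simps
proof (induction rule: generate_ring.induct)
  case one
  show ?case by (auto simp: bdeg_def)
next
  case (incl h)
  then show ?case by (auto simp: symfuns_def bdeg_def)
next
  case (a_inv h)
  then show ?case by (auto simp: bdeg_def pseries_a_inv)
next
  case (eng_add h1 h2)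
  then obtain d e where "bdeg h1 d" "bdeg h2 e" by blast
  then have "bdeg h1 (max d e)" "bdeg h2 (max d e)" by (auto intro: bdeg_mono)
  then show ?case using bdeg_add by blast
next
  case (eng_mult h1 h2)
  then show ?case using bdeg_mult by blast
qed

text \<open>Unlike the support of a series, this finite index set depends only on a degree bound, so
  that several series can be summed over a common range.\<close>

definition mons :: "'v set \<Rightarrow> nat \<Rightarrow> 'v multiset set" where
  "mons F d = {M. set_mset M \<subseteq> F \<and> size M \<le> d}"

lemma finite_mons [simp]: "finite F \<Longrightarrow> finite (mons F d)"
proof -
  assume "finite F"
  then have "finite (\<Union>k\<le>d. multisets_of_size F k)" by auto
  moreover have "mons F d \<subseteq> (\<Union>k\<le>d. multisets_of_size F k)"
    by (auto simp: mons_def multisets_of_size_def)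
  ultimately show ?thesis by (rule finite_subset[rotated])
qed

definition monval :: "('v \<Rightarrow> complex) \<Rightarrow> 'v multiset \<Rightarrow> complex" where
  "monval a M = prod_mset (image_mset a M)"

text \<open>For a series of bounded degree and a finite set \<open>F\<close> of variables, only finitely many
  monomials contribute to the value at a point whose coordinates outside \<open>F\<close> vanish.\<close>

definition pseries_eval :: "'v set \<Rightarrow> ('v \<Rightarrow> complex) \<Rightarrow> 'v pseries \<Rightarrow> complex" where
  "pseries_eval F a f = (\<Sum>M | set_mset M \<subseteq> F \<and> f M \<noteq> 0. of_int (f M) * monval a M)"

lemma pseries_eval_mons:
  assumes "finite F" "bdeg f d"
  shows "pseries_eval F a f = (\<Sum>M\<in>mons F d. of_int (f M) * monval a M)"
  unfolding pseries_eval_def using assms finite_mons[of F d]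
  by (intro sum.mono_neutral_left) (auto simp: mons_def bdeg_def)

lemma pseries_eval_add:
  assumes "finite F" "bdeg f d" "bdeg g e"
  shows "pseries_eval F a (f \<oplus>\<^bsub>pseries_ring\<^esub> g) = pseries_eval F a f + pseries_eval F a g"
proof -
  have "bdeg f (max d e)" "bdeg g (max d e)" using assms by (auto intro: bdeg_mono)
  then show ?thesis
    using assms(1) bdeg_add[of f "max d e" g]
    by (simp add: pseries_eval_mons[of F _ "max d e"] sum.distrib distrib_right)
qed

lemma pseries_eval_mult:
  assumes "finite F" "bdeg f d" "bdeg g e"
  shows "pseries_eval F a (f \<otimes>\<^bsub>pseries_ring\<^esub> g) = pseries_eval F a f * pseries_eval F a g"
proof -
  let ?t = "\<lambda>A B. of_int (f A) * monval a A * (of_int (g B) * monval a B)"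
  have "pseries_eval F a (f \<otimes>\<^bsub>pseries_ring\<^esub> g) =
    (\<Sum>M\<in>mons F (d + e). \<Sum>p | fst p + snd p = M. ?t (fst p) (snd p))"
    unfolding pseries_eval_mons[OF assms(1) bdeg_mult[OF assms(2,3)]]
    by (intro sum.cong refl) (auto simp: sum_distrib_right case_prod_unfold monval_def intro!: sum.cong)
  also have "\<dots> = (\<Sum>(M, p)\<in>Sigma (mons F (d + e)) (\<lambda>M. {p. fst p + snd p = M}). ?t (fst p) (snd p))"
    using finite_mset_splits assms(1) by (intro sum.Sigma) (auto simp: case_prod_unfold)
  \<comment> \<open>A splitting of M whose components violate the bounds \<open>d\<close> and
    \<open>e\<close> contributes 0, so only the pairs in the product of the two index sets
    remain.\<close>
  also have "\<dots> = (\<Sum>(M, p)\<in>(\<lambda>p. (fst p + snd p, p)) ` (mons F d \<times> mons F e). ?t (fst p) (snd p))"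
  proof (intro sum.mono_neutral_right ballI)
    show "finite (Sigma (mons F (d + e)) (\<lambda>M. {p. fst p + snd p = M}))"
      using finite_mset_splits assms(1) by (intro finite_SigmaI) (auto simp: case_prod_unfold)
    show "(\<lambda>p. (fst p + snd p, p)) ` (mons F d \<times> mons F e) \<subseteq>
      Sigma (mons F (d + e)) (\<lambda>M. {p. fst p + snd p = M})"
      by (auto simp: mons_def)
    fix x assume "x \<in> Sigma (mons F (d + e)) (\<lambda>M. {p. fst p + snd p = M}) -
      (\<lambda>p. (fst p + snd p, p)) ` (mons F d \<times> mons F e)"
    then obtain A B where x: "x = (A + B, (A, B))" "A + B \<in> mons F (d + e)"
      "A \<notin> mons F d \<or> B \<notin> mons F e"
      by (cases x) (force simp: image_iff)
    then have "f A = 0 \<or> g B = 0"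
      using assms(2,3) by (auto simp: mons_def bdeg_def)
    then show "(case x of (M, p) \<Rightarrow> ?t (fst p) (snd p)) = 0" using x by auto
  qed
  also have "\<dots> = (\<Sum>p\<in>mons F d \<times> mons F e. ?t (fst p) (snd p))"
    by (subst sum.reindex) (auto simp: inj_on_def)
  also have "\<dots> = pseries_eval F a f * pseries_eval F a g"
    using assms by (simp add: pseries_eval_mons[of F f d] pseries_eval_mons[of F g e]
      sum_product sum.cartesian_product case_prod_unfold)
  finally show ?thesis .
qed

definition complex_ring :: "complex ring" where
  "complex_ring = \<lparr>carrier = UNIV, mult = (*), one = 1, zero = 0, add = (+)\<rparr>"

lemma complex_ring_simps [simp]:
  "carrier complex_ring = UNIV" "mult complex_ring = (*)" "one complex_ring = 1"
  "zero complex_ring = 0" "add complex_ring = (+)"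
  by (simp_all add: complex_ring_def)

lemma cring_complex_ring: "cring complex_ring"
proof (rule cringI)
  show "abelian_group complex_ring"
  proof (rule abelian_groupI)
    fix x show "\<exists>y\<in>carrier complex_ring. y \<oplus>\<^bsub>complex_ring\<^esub> x = \<zero>\<^bsub>complex_ring\<^esub>"
      by (intro bexI[of _ "- x"]) auto
  qed auto
  show "Group.comm_monoid complex_ring"
    by (rule comm_monoidI) auto
qed (auto simp: distrib_right)

lemma pseries_eval_hom:
  assumes "finite F"
  shows "pseries_eval F a \<in> ring_hom sym_XY complex_ring"
proof (rule ring_hom_memI)
  fix f g assume "f \<in> carrier sym_XY" "g \<in> carrier sym_XY"
  then obtain d e where "bdeg f d" "bdeg g e" using bdeg_carrier by blast
  then show
    "pseries_eval F a (f \<otimes>\<^bsub>sym_XY\<^esub> g) = pseries_eval F a f \<otimes>\<^bsub>complex_ring\<^esub> pseries_eval F a g"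
    "pseries_eval F a (f \<oplus>\<^bsub>sym_XY\<^esub> g) = pseries_eval F a f \<oplus>\<^bsub>complex_ring\<^esub> pseries_eval F a g"
    using assms pseries_eval_mult pseries_eval_add by (simp_all add: sym_XY_simps del: pseries_ring_simps)
next
  have "pseries_eval F a \<one>\<^bsub>sym_XY\<^esub> = (\<Sum>M\<in>{{#}}. monval a M)"
    unfolding pseries_eval_def by (rule sum.cong) (auto simp: sym_XY_simps)
  then show "pseries_eval F a \<one>\<^bsub>sym_XY\<^esub> = \<one>\<^bsub>complex_ring\<^esub>" by (simp add: monval_def)
qed simp

section \<open>Generating functions and the choice of the specialisation\<close>

definition hs :: "'v set \<Rightarrow> ('v \<Rightarrow> complex) \<Rightarrow> nat \<Rightarrow> complex" where
  "hs S a n = (\<Sum>M\<in>multisets_of_size S n. monval a M)"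

definition es :: "'v set \<Rightarrow> ('v \<Rightarrow> complex) \<Rightarrow> nat \<Rightarrow> complex" where
  "es S a n = (\<Sum>M | M \<in> multisets_of_size S n \<and> (\<forall>v. count M v \<le> 1). monval a M)"

lemma pseries_eval_complete_sym: "pseries_eval F a (complete_sym V n) = hs (F \<inter> V) a n"
  unfolding pseries_eval_def hs_def
  by (intro sum.cong) (auto simp: complete_sym_def multisets_of_size_def)

lemma pseries_eval_elem_sym: "pseries_eval F a (elem_sym V n) = es (F \<inter> V) a n"
  unfolding pseries_eval_def es_def
  by (intro sum.cong) (auto simp: elem_sym_def multisets_of_size_def)

lemma monval_simps [simp]: "monval a {#} = 1" "monval a (add_mset x M) = a x * monval a M"
  by (simp_all add: monval_def)

lemma hs_0 [simp]: "hs S a 0 = 1"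
  by (simp add: hs_def)

lemma es_0 [simp]: "es S a 0 = 1"
proof -
  have "{M \<in> multisets_of_size S 0. \<forall>v. count M v \<le> 1} = {{#}}" by auto
  then show ?thesis by (simp add: es_def)
qed

text \<open>Monomials are split according to whether \<open>x\<close> occurs. After removal of one
  copy, \<open>x\<close> may occur again, hence \<open>insert x S\<close> in the last term.\<close>

lemma hs_insert_Suc:
  assumes "finite S" "x \<notin> S"
  shows "hs (insert x S) a (Suc n) = hs S a (Suc n) + a x * hs (insert x S) a n"
proof -
  let ?M = multisets_of_size
  have "?M (insert x S) (Suc n) = ?M S (Suc n) \<union> add_mset x ` ?M (insert x S) n" (is "?L = ?R")
  proof (intro equalityI subsetI)
    fix A assume A: "A \<in> ?L"
    show "A \<in> ?R"
    proof (cases "x \<in># A")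
      case True
      then obtain B where "A = add_mset x B" by (metis insert_DiffM)
      then show ?thesis using A by (auto simp: multisets_of_size_def)
    qed (use A in \<open>auto simp: multisets_of_size_def\<close>)
  qed (auto simp: multisets_of_size_def)
  moreover have "?M S (Suc n) \<inter> add_mset x ` ?M (insert x S) n = {}"
    using assms(2) by (auto simp: multisets_of_size_def)
  ultimately have "hs (insert x S) a (Suc n) =
    hs S a (Suc n) + (\<Sum>M\<in>add_mset x ` ?M (insert x S) n. monval a M)"
    unfolding hs_def using assms(1)
    by (simp only:) (rule sum.union_disjoint, auto)
  also have "(\<Sum>M\<in>add_mset x ` ?M (insert x S) n. monval a M) = a x * hs (insert x S) a n"
    unfolding hs_def by (subst sum.reindex) (auto simp: inj_on_def sum_distrib_left)
  finally show ?thesis .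
qed

text \<open>Here squarefreeness forbids a second copy of \<open>x\<close>, so the last term involves
  \<open>S\<close> only.\<close>

lemma es_insert_Suc:
  assumes "finite S" "x \<notin> S"
  shows "es (insert x S) a (Suc n) = es S a (Suc n) + a x * es S a n"
proof -
  let ?M = "\<lambda>S n. {M \<in> multisets_of_size S n. \<forall>v. count M v \<le> 1}"
  have "?M (insert x S) (Suc n) = ?M S (Suc n) \<union> add_mset x ` ?M S n" (is "?L = ?R")
  proof (intro equalityI subsetI)
    fix A assume A: "A \<in> ?L"
    show "A \<in> ?R"
    proof (cases "x \<in># A")
      case True
      then obtain B where B: "A = add_mset x B" by (metis insert_DiffM)
      have "count B v \<le> 1" for v
        using A B by (metis (mono_tags, lifting) count_add_mset le_SucI mem_Collect_eq not_less_eq_eq)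
      moreover have "count A x \<le> 1" using A by blast
      then have "x \<notin># B" by (simp add: B not_in_iff)
      ultimately show ?thesis using A B by (auto simp: multisets_of_size_def)
    qed (use A in \<open>auto simp: multisets_of_size_def\<close>)
  next
    fix A assume "A \<in> ?R"
    then consider "A \<in> ?M S (Suc n)" | B where "A = add_mset x B" "B \<in> ?M S n" by blast
    then show "A \<in> ?L"
    proof cases
      case 2
      then have "count B x = 0" using assms(2) by (auto simp: multisets_of_size_def not_in_iff[symmetric])
      then show ?thesis using 2 by (auto simp: multisets_of_size_def)
    qed (auto simp: multisets_of_size_def)
  qed
  moreover have "?M S (Suc n) \<inter> add_mset x ` ?M S n = {}"
    using assms(2) by (auto simp: multisets_of_size_def)
  ultimately have "es (insert x S) a (Suc n) =
    es S a (Suc n) + (\<Sum>M\<in>add_mset x ` ?M S n. monval a M)"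
    unfolding es_def using assms(1)
    by (simp only:) (rule sum.union_disjoint, auto intro!: finite_imageI finite_subset[OF _ finite_multisets_of_size])
  also have "(\<Sum>M\<in>add_mset x ` ?M S n. monval a M) = a x * es S a n"
    unfolding es_def by (subst sum.reindex) (auto simp: inj_on_def sum_distrib_left)
  finally show ?thesis .
qed

lemma fps_es: "finite S \<Longrightarrow> Abs_fps (es S a) = (\<Prod>x\<in>S. 1 + fps_const (a x) * fps_X)"
proof (induction S rule: finite_induct)
  case empty
  have "es {} a n = (if n = 0 then 1 else 0)" for n
    by (cases "n = 0") (simp_all add: es_def[of _ _ n])
  then show ?case by (simp add: fps_eq_iff)
next
  case (insert x S)
  have "Abs_fps (es (insert x S) a) = (1 + fps_const (a x) * fps_X) * Abs_fps (es S a)"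
  proof (rule fps_ext)
    fix n show "fps_nth (Abs_fps (es (insert x S) a)) n =
      fps_nth ((1 + fps_const (a x) * fps_X) * Abs_fps (es S a)) n"
      using insert(1,2) by (cases n) (simp_all add: es_insert_Suc distrib_right mult.assoc)
  qed
  then show ?case using insert by simp
qed

text \<open>This is the identity H(-t) E(t) = 1. The recursion for \<open>hs\<close> says that
  multiplication by 1 + a_x t removes the variable \<open>x\<close> from H(-t).\<close>

lemma fps_hs:
  "finite S \<Longrightarrow> Abs_fps (\<lambda>n. (-1) ^ n * hs S a n) * (\<Prod>x\<in>S. 1 + fps_const (a x) * fps_X) = 1"
proof (induction S rule: finite_induct)
  case empty
  have "hs {} a n = (if n = 0 then 1 else 0)" for n
    by (cases "n = 0") (simp_all add: hs_def[of _ _ n])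
  then show ?case by (simp add: fps_eq_iff)
next
  case (insert x S)
  have "(1 + fps_const (a x) * fps_X) * Abs_fps (\<lambda>n. (-1) ^ n * hs (insert x S) a n) =
    Abs_fps (\<lambda>n. (-1) ^ n * hs S a n)"
  proof (rule fps_ext)
    fix n show "fps_nth ((1 + fps_const (a x) * fps_X) * Abs_fps (\<lambda>n. (-1) ^ n * hs (insert x S) a n)) n =
      fps_nth (Abs_fps (\<lambda>n. (-1) ^ n * hs S a n)) n"
      using insert(1,2)
      by (cases n) (simp_all add: hs_insert_Suc distrib_right distrib_left mult.assoc)
  qed
  then show ?case using insert by (simp add: mult.assoc[symmetric] mult.commute)
qed

text \<open>Together with \<open>fps_es\<close> this realises any complex polynomial with constant
  coefficient 1 as the generating function of the e_n at finitely many values.\<close>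

lemma complex_poly_factor:
  fixes p :: "complex poly"
  assumes "coeff p 0 = 1"
  shows "\<exists>N c. p = (\<Prod>i<N::nat. [:1, c i:])"
  using assms
proof (induction "degree p" arbitrary: p)
  case 0
  then have "p = 1" by (metis degree_eq_zeroE coeff_pCons_0 one_pCons)
  then show ?case by (intro exI[of _ 0]) simp
next
  case (Suc k)
  then obtain z where z: "poly p z = 0"
    by (metis constant_degree fundamental_theorem_of_algebra nat.distinct(1))
  then obtain q where q: "p = [:-z, 1:] * q" by (metis poly_eq_0_iff_dvd dvdE)
  \<comment> \<open>The constant coefficient 1 excludes the root 0, so the factor X - z can be
    rescaled to 1 - X/z.\<close>
  have "z \<noteq> 0" using z Suc.prems by (auto simp: poly_0_coeff_0)
  define q' where "q' = smult (-z) q"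
  have "[:-z, 1:] = smult (-z) [:1, -1/z:]" using \<open>z \<noteq> 0\<close> by simp
  then have p: "p = [:1, -1/z:] * q'"
    unfolding q q'_def by (simp only: mult_smult_left mult_smult_right)
  have "q' \<noteq> 0" using p Suc.prems by auto
  then have "degree p = Suc (degree q')"
    using p \<open>z \<noteq> 0\<close> by (simp del: mult_pCons_left add: degree_mult_eq)
  moreover have "coeff q' 0 = 1" using p Suc.prems by (simp add: coeff_mult)
  ultimately obtain N c where "q' = (\<Prod>i<N::nat. [:1, c i:])"
    using Suc.hyps by (metis diff_Suc_1)
  then have "p = (\<Prod>i<Suc N. [:1, (c(N := -1/z)) i:])"
    using p by (simp del: mult_pCons_left mult_pCons_right add: mult.commute)
  then show ?case by blast
qed

lemma fps_of_poly_linear_prod: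
  "fps_of_poly (\<Prod>i<N::nat. [:1, c i:]) = (\<Prod>i<N. 1 + fps_const (c i :: complex) * fps_X)"
  by (simp add: fps_of_poly_prod fps_of_poly_pCons)

lemma coeff_sum_monom:
  assumes "0 < m"
  shows "coeff (\<Sum>s\<le>n. monom (f s) (s * m)) k = (if m dvd k \<and> k \<le> n * m then f (k div m) else 0)"
proof -
  have "coeff (\<Sum>s\<le>n. monom (f s) (s * m)) k = (\<Sum>s\<le>n. if s * m = k then f s else 0)"
    by (simp add: coeff_sum)
  also have "\<dots> = (\<Sum>s\<in>(if m dvd k \<and> k \<le> n * m then {k div m} else {}). f s)"
    using assms by (intro sum.mono_neutral_cong_right) (auto split: if_splits)
  finally show ?thesis by simp
qed

lemma evaluation_exists:
  fixes v :: "nat \<Rightarrow> complex"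
  assumes "0 < m" "v 0 = 1"
  shows "\<exists>F a. finite F \<and>
    (\<forall>i\<le>n. pseries_eval F a (complete_sym Xvars i) = v i) \<and>
    (\<forall>s. s * m \<le> n \<longrightarrow> pseries_eval F a (elem_sym Yvars (s * m)) = 1) \<and>
    (\<forall>d. \<not> m dvd d \<longrightarrow> (\<Sum>i\<le>d. (-1) ^ i *
       (pseries_eval F a (complete_sym Xvars i) * pseries_eval F a (elem_sym Yvars (d - i)))) = 0)"
proof -
  \<comment> \<open>The negated values of the \<open>x\<^sub>i\<close> are the reciprocal roots of the polynomial \<open>P\<close> and those of the
    \<open>y\<^sub>j\<close> are those of \<open>P Q\<close>, so the relations become the coefficients of \<open>Q\<close>, a polynomial in
    the \<open>m\<close>-th power of the variable. \<open>P\<close> is a truncated reciprocal of the prescribed series,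
    and \<open>q\<close> is chosen such that \<open>P Q\<close> has the coefficient \<open>1\<close> in each degree \<open>s m \<le> n\<close>.\<close>
  define V where "V = Abs_fps (\<lambda>i. (-1) ^ i * v i)"
  have V0: "fps_nth V 0 = 1" using assms by (simp add: V_def)
  define P where "P = (\<Sum>i\<le>n. monom (fps_nth (inverse V) i) (i * 1))"
  have coeff_P: "coeff P k = (if k \<le> n then fps_nth (inverse V) k else 0)" for k
    unfolding P_def by (subst coeff_sum_monom) auto
  have P0: "coeff P 0 = 1" by (simp add: coeff_P V0)
  define R where "R = Abs_fps (\<lambda>s. coeff P (s * m))"
  have R0: "fps_nth R 0 = 1" by (simp add: R_def P0)
  \<comment> \<open>In degrees divisible by \<open>m\<close>, only the part R(t^m) of P meets Q =
    q(t^m). The coefficients there are 1 if q R is the geometric series.\<close>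
  define q where "q = Abs_fps (\<lambda>_. 1) * inverse R"
  have q0: "fps_nth q 0 = 1" by (simp add: q_def R0)
  have qR: "q * R = Abs_fps (\<lambda>_. 1)"
    using R0 by (simp add: q_def mult.assoc inverse_mult_eq_1)
  define Q where "Q = (\<Sum>s\<le>n. monom (fps_nth q s) (s * m))"
  have coeff_Q: "coeff Q k = (if m dvd k \<and> k \<le> n * m then fps_nth q (k div m) else 0)" for k
    unfolding Q_def by (rule coeff_sum_monom[OF assms(1)])
  have "coeff (P * Q) 0 = 1" by (simp add: coeff_mult P0 coeff_Q q0)
  then obtain K b where b: "P * Q = (\<Prod>i<K::nat. [:1, b i:])" using complex_poly_factor by blast
  obtain N c where c: "P = (\<Prod>i<N::nat. [:1, c i:])" using P0 complex_poly_factor by blast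
  define F where "F = Inl ` {..<N} \<union> Inr ` {..<K}"
  define a where "a = case_sum c b"
  define h where "h = (\<lambda>i. pseries_eval F a (complete_sym Xvars i))"
  define e where "e = (\<lambda>i. pseries_eval F a (elem_sym Yvars i))"
  have "finite F" by (simp add: F_def)
  have FX: "F \<inter> Xvars = Inl ` {..<N}" and FY: "F \<inter> Yvars = Inr ` {..<K}"
    by (auto simp: F_def Xvars_def Yvars_def)
  have e: "Abs_fps e = fps_of_poly (P * Q)"
    unfolding b fps_of_poly_linear_prod e_def pseries_eval_elem_sym FY
    by (subst fps_es) (simp_all add: prod.reindex a_def)
  \<comment> \<open>With H(-t) P = 1 and E(t) = P Q, the product H(-t) E(t) is Q, which has no terms
    in degrees prime to the divisibility by \<open>m\<close>.\<close>
  have hP: "Abs_fps (\<lambda>n. (-1) ^ n * h n) * fps_of_poly P = 1"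
    unfolding c fps_of_poly_linear_prod h_def pseries_eval_complete_sym FX
    using fps_hs[of "Inl ` {..<N}" a] by (simp add: prod.reindex a_def)
  have "h k = v k" if "k \<le> n" for k
  proof -
    let ?H = "Abs_fps (\<lambda>n. (-1) ^ n * h n)"
    have VP: "fps_nth (V * fps_of_poly P) i = (if i = 0 then 1 else 0)" if "i \<le> n" for i
    proof -
      have "fps_nth (V * fps_of_poly P) i = fps_nth (V * inverse V) i"
        using that by (auto simp: fps_mult_nth coeff_P intro!: sum.cong)
      also have "V * inverse V = 1" using V0 by (simp add: inverse_mult_eq_1')
      finally show ?thesis by simp
    qed
    \<comment> \<open>V P agrees with 1 up to degree \<open>n\<close>, since truncation affected
      only higher degrees. Hence V and H(-t) agree up to degree \<open>n\<close>.\<close>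
    have "V = V * fps_of_poly P * ?H" using hP by (metis mult.assoc mult.commute mult.right_neutral)
    then have "fps_nth V k = (\<Sum>i=0..k. fps_nth (V * fps_of_poly P) i * fps_nth ?H (k - i))"
      by (metis fps_mult_nth)
    also have "\<dots> = (\<Sum>i=0..k. if i = 0 then fps_nth ?H k else 0)"
      using that by (intro sum.cong) (auto simp: VP simp del: fps_nth_Abs_fps)
    also have "\<dots> = fps_nth ?H k" by simp
    finally show ?thesis by (simp add: V_def)
  qed
  moreover have "e (s * m) = 1" if "s * m \<le> n" for s
  proof -
    \<comment> \<open>This bound ensures that the coefficients of q in use survive in the truncation
      Q.\<close>
    have "s \<le> n" using that assms by (metis le_trans mult.commute mult_le_mono1 nat_mult_1 One_nat_def Suc_leI)
    have "e (s * m) = coeff (P * Q) (s * m)"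
      using arg_cong[OF e, of "\<lambda>f. fps_nth f (s * m)"] by simp
    also have "\<dots> = (\<Sum>i\<le>s * m. coeff Q i * coeff P (s * m - i))"
      by (simp add: mult.commute[of P] coeff_mult)
    also have "\<dots> = (\<Sum>i\<in>(\<lambda>k. k * m) ` {..s}. coeff Q i * coeff P (s * m - i))"
    proof (rule sum.mono_neutral_right)
      show "\<forall>i\<in>{..s * m} - (\<lambda>k. k * m) ` {..s}. coeff Q i * coeff P (s * m - i) = 0"
      proof
        fix i assume i: "i \<in> {..s * m} - (\<lambda>k. k * m) ` {..s}"
        have "\<not> m dvd i"
        proof
          assume "m dvd i"
          then obtain k where "i = k * m" by (metis dvd_def mult.commute)
          then show False using i assms by auto
        qed
        then show "coeff Q i * coeff P (s * m - i) = 0" by (simp add: coeff_Q)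
      qed
    qed auto
    also have "\<dots> = (\<Sum>k\<le>s. coeff Q (k * m) * coeff P (s * m - k * m))"
      using assms by (subst sum.reindex) (auto simp: inj_on_def)
    also have "\<dots> = (\<Sum>k\<le>s. fps_nth q k * fps_nth R (s - k))"
      using \<open>s \<le> n\<close> assms by (intro sum.cong) (auto simp: coeff_Q R_def diff_mult_distrib)
    also have "\<dots> = fps_nth (q * R) s" by (simp add: fps_mult_nth atLeast0AtMost)
    finally show ?thesis by (simp add: qR)
  qed
  moreover have "(\<Sum>i\<le>d. (-1) ^ i * (h i * e (d - i))) = 0" if "\<not> m dvd d" for d
  proof -
    have "(\<Sum>i\<le>d. (-1) ^ i * (h i * e (d - i))) = fps_nth (Abs_fps (\<lambda>n. (-1) ^ n * h n) * Abs_fps e) d"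
      by (simp add: fps_mult_nth atLeast0AtMost mult.assoc)
    also have "Abs_fps (\<lambda>n. (-1) ^ n * h n) * Abs_fps e = fps_of_poly Q"
      using hP by (simp add: e fps_of_poly_mult mult.assoc[symmetric])
    finally show ?thesis using that by (simp add: coeff_Q)
  qed
  ultimately show ?thesis using \<open>finite F\<close> unfolding h_def e_def by blast
qed

section \<open>The expansion of the elementary functions\<close>

text \<open>These compositions record the runs of the recursion for e_n. After k parts the index of
  e is (n - |\<delta>|) plus the sum of the remaining parts; the recursion stops as soon as
  \<open>m\<close> divides this index, hence the condition on suffixes.\<close>

definition suffix_comps :: "nat \<Rightarrow> nat \<Rightarrow> nat list set" where
  "suffix_comps m n = {\<delta>. is_composition \<delta> \<and> sum_list \<delta> \<le> n \<and> m dvd n - sum_list \<delta> \<and>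
     (\<forall>k<length \<delta>. \<not> m dvd sum_list (drop k \<delta>))}"

lemma length_le_sum_list: "is_composition \<delta> \<Longrightarrow> length \<delta> \<le> sum_list \<delta>"
  by (induction \<delta>) (auto simp: is_composition_def)

lemma finite_comps_le: "finite {\<delta>. is_composition \<delta> \<and> sum_list \<delta> \<le> n}"
proof (rule finite_subset)
  have "length \<delta> \<le> n" if "is_composition \<delta>" "sum_list \<delta> \<le> n" for \<delta>
    using length_le_sum_list that le_trans by blast
  then show "{\<delta>. is_composition \<delta> \<and> sum_list \<delta> \<le> n} \<subseteq> {\<delta>. set \<delta> \<subseteq> {..n} \<and> length \<delta> \<le> n}"
    using member_le_sum_list le_trans by (fastforce simp: subset_iff)
qed (simp add: finite_lists_length_le)

lemma finite_suffix_comps [simp]: "finite (suffix_comps m n)"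
  by (rule finite_subset[OF _ finite_comps_le[of n]]) (auto simp: suffix_comps_def)

lemma suffix_comps_dvd: "m dvd n \<Longrightarrow> suffix_comps m n = {[]}"
proof (intro equalityI subsetI)
  fix \<delta> assume "m dvd n" and \<delta>: "\<delta> \<in> suffix_comps m n"
  then have "m dvd n - sum_list \<delta>" "sum_list \<delta> \<le> n" by (simp_all add: suffix_comps_def)
  then have "m dvd sum_list \<delta>" using \<open>m dvd n\<close> dvd_diffD1 by blast
  moreover have "\<delta> \<noteq> [] \<Longrightarrow> \<not> m dvd sum_list \<delta>"
    using \<delta> by (auto simp: suffix_comps_def dest!: spec[of _ 0])
  ultimately show "\<delta> \<in> {[]}" by blast
qed (auto simp: suffix_comps_def is_composition_def)

text \<open>One step of the recursion: the first part is arbitrary, the conditions on proper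
  suffixes are those of the tail, and the condition on the whole list follows from the assumption on
  \<open>n\<close>.\<close>

lemma suffix_comps_not_dvd:
  assumes "\<not> m dvd n"
  shows "suffix_comps m n = (\<Union>i\<in>{1..n}. (#) i ` suffix_comps m (n - i))"
proof (intro equalityI subsetI)
  fix \<delta> assume \<delta>: "\<delta> \<in> suffix_comps m n"
  then obtain i \<delta>' where eq: "\<delta> = i # \<delta>'" using assms by (cases \<delta>) (auto simp: suffix_comps_def)
  have "\<not> m dvd sum_list (drop k \<delta>')" if "k < length \<delta>'" for k
    using \<delta> that unfolding suffix_comps_def eq by (auto dest!: spec[of _ "Suc k"])
  then have "\<delta>' \<in> suffix_comps m (n - i)" "i \<in> {1..n}"
    using \<delta> eq by (auto simp: suffix_comps_def is_composition_def)
  then show "\<delta> \<in> (\<Union>i\<in>{1..n}. (#) i ` suffix_comps m (n - i))" using eq by blast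
next
  fix \<delta> assume "\<delta> \<in> (\<Union>i\<in>{1..n}. (#) i ` suffix_comps m (n - i))"
  then obtain i \<delta>' where i: "1 \<le> i" "i \<le> n" "\<delta> = i # \<delta>'" "\<delta>' \<in> suffix_comps m (n - i)" by auto
  then have sum: "sum_list \<delta> \<le> n" "m dvd n - sum_list \<delta>" by (auto simp: suffix_comps_def)
  have "\<not> m dvd sum_list (drop k \<delta>)" if "k < length \<delta>" for k
  proof (cases k)
    case 0
    then show ?thesis using assms sum by (metis drop0 dvd_diffD)
  qed (use i that in \<open>auto simp: suffix_comps_def\<close>)
  then show "\<delta> \<in> suffix_comps m n"
    using sum i by (auto simp: suffix_comps_def is_composition_def)
qed

lemma eps_Nil [simp]: "eps [] = 1"
  by (simp add: eps_def)

lemma eps_Cons: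
  assumes "is_composition (i # \<delta>)"
  shows "eps (i # \<delta>) = (-1) ^ Suc i * eps \<delta>"
proof -
  \<comment> \<open>Positive parts keep the truncated subtraction in \<open>eps\<close>
    exact.\<close>
  have "length \<delta> \<le> sum_list \<delta>" "0 < i"
    using assms length_le_sum_list by (auto simp: is_composition_def)
  then have "sum_list (i # \<delta>) - length (i # \<delta>) = (i - 1) + (sum_list \<delta> - length \<delta>)" by simp
  then have "eps (i # \<delta>) = (-1) ^ (i - 1) * eps \<delta>"
    unfolding eps_def by (simp only: power_add)
  also have "(-1 :: int) ^ (i - 1) = (-1) ^ Suc i" using \<open>0 < i\<close> by (cases i) auto
  finally show ?thesis .
qed

lemma eps_mset_cong: "mset \<delta> = mset \<mu> \<Longrightarrow> eps \<delta> = eps \<mu>"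
  unfolding eps_def by (metis mset_eq_length sum_mset_sum_list)

lemma finite_exp_index [simp]: "0 < m \<Longrightarrow> finite (exp_index m n)"
proof -
  assume m: "0 < m"
  have "exp_index m n \<subseteq> {\<mu>. is_composition \<mu> \<and> sum_list \<mu> \<le> n} \<times> {..n}"
  proof
    fix p assume "p \<in> exp_index m n"
    then obtain \<mu> s where p: "p = (\<mu>, s)" "is_partition \<mu>" "sum_list \<mu> + s * m = n"
      by (auto simp: exp_index_def)
    moreover have "s \<le> s * m" using m by simp
    ultimately have "s \<le> n" by linarith
    then show "p \<in> {\<mu>. is_composition \<mu> \<and> sum_list \<mu> \<le> n} \<times> {..n}"
      using p by (auto simp: is_partition_def)
  qed
  then show ?thesis using finite_comps_le by (metis finite_SigmaI finite_atMost finite_subset)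
qed

text \<open>Reversal turns the suffix starting at k into the prefix of length
  \<open>length \<delta> - k\<close>, so k < \<open>length \<delta>\<close> matches the range of
  prefixes in \<open>cm_num\<close>.\<close>

lemma card_suffix_comps_of_type:
  assumes "p \<in> exp_index m n"
  shows "card {\<delta> \<in> suffix_comps m n. mset \<delta> = mset (fst p)} = cm_num m (fst p)"
proof -
  let ?\<mu> = "fst p"
  have p: "sum_list ?\<mu> + snd p * m = n" "is_composition ?\<mu>"
    using assms by (auto simp: exp_index_def is_partition_def)
  let ?C = "{\<delta> \<in> comps_of_type ?\<mu>. \<forall>j\<in>{1..length ?\<mu>}. \<not> [sum_list (take j \<delta>) = 0] (mod m)}"
  have "{\<delta> \<in> suffix_comps m n. mset \<delta> = mset ?\<mu>} = rev ` ?C" (is "?L = _")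
  proof -
    have iff: "\<delta> \<in> ?L \<longleftrightarrow> rev \<delta> \<in> ?C" for \<delta>
    proof (cases "mset \<delta> = mset ?\<mu>")
      case True
      then have sum: "sum_list \<delta> = sum_list ?\<mu>" and len: "length \<delta> = length ?\<mu>"
        by (metis sum_mset_sum_list, metis size_mset)
      have "(\<forall>k<length \<delta>. \<not> m dvd sum_list (drop k \<delta>)) \<longleftrightarrow>
        (\<forall>j\<in>{1..length \<delta>}. \<not> m dvd sum_list (take j (rev \<delta>)))"
      proof safe
        fix j assume "\<forall>k<length \<delta>. \<not> m dvd sum_list (drop k \<delta>)" "j \<in> {1..length \<delta>}"
          "m dvd sum_list (take j (rev \<delta>))"
        then show False by (auto simp: take_rev sum_list_rev dest!: spec[of _ "length \<delta> - j"])
      next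
        fix k assume "\<forall>j\<in>{1..length \<delta>}. \<not> m dvd sum_list (take j (rev \<delta>))" "k < length \<delta>"
          "m dvd sum_list (drop k \<delta>)"
        then show False by (auto simp: take_rev sum_list_rev dest!: bspec[of _ _ "length \<delta> - k"])
      qed
      moreover have "sum_list \<delta> \<le> n" "n - sum_list \<delta> = snd p * m" using p sum by auto
      moreover have "is_composition \<delta>" using p True is_composition_mset_cong by blast
      ultimately show ?thesis
        using True len by (simp add: suffix_comps_def comps_of_type_def cong_0_iff is_composition_def)
    qed (simp add: comps_of_type_def)
    show ?thesis
    proof (intro equalityI subsetI)
      fix \<delta> assume "\<delta> \<in> ?L"
      then show "\<delta> \<in> rev ` ?C" using iff by (intro image_eqI[of _ _ "rev \<delta>"]) simp_all
    next
      fix \<delta> assume "\<delta> \<in> rev ` ?C"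
      then obtain \<gamma> where "\<gamma> \<in> ?C" "\<delta> = rev \<gamma>" by (rule imageE)
      then show "\<delta> \<in> ?L" using iff[of \<delta>] by (simp only: rev_rev_ident)
    qed
  qed
  moreover have "inj_on rev ?C" by (simp add: inj_on_def)
  ultimately show ?thesis by (simp only: card_image cm_num_def)
qed

section \<open>The expansion in an arbitrary commutative ring\<close>

definition mono_prod :: "('a, 'b) ring_scheme \<Rightarrow> (nat \<Rightarrow> 'a) \<Rightarrow> nat list \<Rightarrow> 'a" where
  "mono_prod R h \<delta> = foldr (\<otimes>\<^bsub>R\<^esub>) (map h \<delta>) \<one>\<^bsub>R\<^esub>"

lemma mono_prod_simps [simp]:
  "mono_prod R h [] = \<one>\<^bsub>R\<^esub>" "mono_prod R h (i # \<delta>) = h i \<otimes>\<^bsub>R\<^esub> mono_prod R h \<delta>"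
  by (simp_all add: mono_prod_def)

context cring
begin

lemma mono_prod_closed [simp]: "(\<And>i. h i \<in> carrier R) \<Longrightarrow> mono_prod R h \<delta> \<in> carrier R"
  by (induction \<delta>) auto

lemma mono_prod_mset_cong:
  assumes "\<And>i. h i \<in> carrier R" "mset \<delta> = mset \<mu>"
  shows "mono_prod R h \<delta> = mono_prod R h \<mu>"
  unfolding mono_prod_def using assms by (intro multlist_perm_cong) (auto simp: mset_map)

lemma add_pow_int_closed [simp]: "a \<in> carrier R \<Longrightarrow> [(k::int)] \<cdot> a \<in> carrier R"
  by (rule add.int_pow_closed)

lemma add_pow_mult_add_pow:
  assumes "a \<in> carrier R" "b \<in> carrier R"
  shows "[(k::int)] \<cdot> (a \<otimes> [(l::int)] \<cdot> b) = [(k * l)] \<cdot> (a \<otimes> b)"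
  using assms by (simp add: add_pow_rdistr_int add.int_pow_pow mult.commute)

lemma add_pow_finsum:
  assumes "finite A" "\<And>x. x \<in> A \<Longrightarrow> f x \<in> carrier R"
  shows "[(k::int)] \<cdot> (\<Oplus>x\<in>A. f x) = (\<Oplus>x\<in>A. [k] \<cdot> f x)"
proof -
  \<comment> \<open>An integer multiple is a product with the ring element [k] 1, so distributivity
    of the ring applies.\<close>
  have one: "[k] \<cdot> b = ([k] \<cdot> \<one>) \<otimes> b" if "b \<in> carrier R" for b
    using that by (simp add: add_pow_ldistr_int)
  have "[k] \<cdot> (\<Oplus>x\<in>A. f x) = ([k] \<cdot> \<one>) \<otimes> (\<Oplus>x\<in>A. f x)"
    using assms by (intro one) (auto intro!: finsum_closed)
  also have "\<dots> = (\<Oplus>x\<in>A. ([k] \<cdot> \<one>) \<otimes> f x)"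
    using assms by (intro finsum_rdistr) auto
  also have "\<dots> = (\<Oplus>x\<in>A. [k] \<cdot> f x)"
    using assms by (intro finsum_cong') (auto simp: add_pow_ldistr_int)
  finally show ?thesis .
qed

text \<open>Strong induction on \<open>n\<close>: if \<open>m\<close> divides \<open>n\<close>, only
  the empty composition occurs; otherwise the relation is solved for \<open>e n\<close> and each
  \<open>e (n - i)\<close> is expanded.\<close>

lemma elementary_expansion_comps:
  assumes h: "\<And>i. h i \<in> carrier R" and e: "\<And>i. e i \<in> carrier R" and h0: "h 0 = \<one>"
    and rel: "\<And>d. \<not> m dvd d \<Longrightarrow> (\<Oplus>i\<in>{0..d}. [((-1 :: int) ^ i)] \<cdot> (h i \<otimes> e (d - i))) = \<zero>"
  shows "e n = (\<Oplus>\<delta>\<in>suffix_comps m n. [eps \<delta>] \<cdot> (mono_prod R h \<delta> \<otimes> e (n - sum_list \<delta>)))"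
proof (induction n rule: less_induct)
  case (less n)
  let ?G = "\<lambda>n \<delta>. [eps \<delta>] \<cdot> (mono_prod R h \<delta> \<otimes> e (n - sum_list \<delta>))"
  have G: "?G n \<delta> \<in> carrier R" for n \<delta> using h e by simp
  show ?case
  proof (cases "m dvd n")
    case True
    then show ?thesis using e by (simp add: suffix_comps_dvd add.int_pow_1)
  next
    case False
    \<comment> \<open>The shift \<open>k\<close> of the exponent gives both signs:
      \<open>?S 0\<close> collects the terms with i > 0 of the relation and \<open>?S 1\<close> is
      its negative, which equals \<open>e n\<close>.\<close>
    let ?S = "\<lambda>k. \<Oplus>i\<in>{1..n}. [((-1 :: int) ^ (i + k))] \<cdot> (h i \<otimes> e (n - i))"
    have S: "?S k \<in> carrier R" for k using h e by (intro finsum_closed) auto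
    have "\<zero> = (\<Oplus>i\<in>insert 0 {1..n}. [((-1 :: int) ^ i)] \<cdot> (h i \<otimes> e (n - i)))"
      using rel[OF False] by (metis atLeastAtMost_insertL le0 One_nat_def)
    also have "\<dots> = e n \<oplus> ?S 0"
      using h e by (subst finsum_insert) (auto simp: h0 add.int_pow_1)
    finally have 1: "e n \<oplus> ?S 0 = \<zero>" by simp
    have "?S 0 \<oplus> ?S 1 = (\<Oplus>i\<in>{1..n}. [((-1 :: int) ^ (i + 0))] \<cdot> (h i \<otimes> e (n - i)) \<oplus>
        [((-1 :: int) ^ (i + 1))] \<cdot> (h i \<otimes> e (n - i)))"
      using h e by (intro finsum_addf[symmetric]) auto
    also have "\<dots> = (\<Oplus>i\<in>{1..n}. \<zero>)"
      using h e by (intro finsum_cong' refl) (auto simp: add.int_pow_mult[symmetric] add_pow_int_ge[of 0])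
    finally have 2: "?S 0 \<oplus> ?S 1 = \<zero>" by simp
    have "e n = e n \<oplus> (?S 0 \<oplus> ?S 1)" using 2 e by simp
    also have "\<dots> = (e n \<oplus> ?S 0) \<oplus> ?S 1"
      by (rule a_assoc[OF e S S, symmetric])
    also have "\<dots> = ?S 1" unfolding 1 by (rule l_zero[OF S])
    finally have "e n = ?S 1" .
    also have "\<dots> = (\<Oplus>i\<in>{1..n}. \<Oplus>\<delta>\<in>(#) i ` suffix_comps m (n - i). ?G n \<delta>)"
    proof (intro finsum_cong' refl)
      fix i assume i: "i \<in> {1..n}"
      let ?D = "suffix_comps m (n - i)"
      have "[((-1 :: int) ^ (i + 1))] \<cdot> (h i \<otimes> e (n - i)) =
        [((-1 :: int) ^ (i + 1))] \<cdot> (h i \<otimes> (\<Oplus>\<delta>\<in>?D. ?G (n - i) \<delta>))"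
        using less.IH[of "n - i"] i by simp
      also have "\<dots> = [((-1 :: int) ^ (i + 1))] \<cdot> (\<Oplus>\<delta>\<in>?D. h i \<otimes> ?G (n - i) \<delta>)"
        using h e G by (subst finsum_rdistr) auto
      also have "\<dots> = (\<Oplus>\<delta>\<in>?D. [((-1 :: int) ^ (i + 1))] \<cdot> (h i \<otimes> ?G (n - i) \<delta>))"
        using h e by (intro add_pow_finsum) auto
      also have "\<dots> = (\<Oplus>\<delta>\<in>?D. ?G n (i # \<delta>))"
      proof (intro finsum_cong' refl)
        fix \<delta> assume \<delta>: "\<delta> \<in> ?D"
        then have "eps (i # \<delta>) = (-1) ^ (i + 1) * eps \<delta>"
          using i by (subst eps_Cons) (auto simp: suffix_comps_def is_composition_def)
        then show "[((-1 :: int) ^ (i + 1))] \<cdot> (h i \<otimes> ?G (n - i) \<delta>) = ?G n (i # \<delta>)"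
          using h e by (simp add: add_pow_mult_add_pow m_assoc)
      qed (use h e in auto)
      also have "\<dots> = (\<Oplus>\<delta>\<in>(#) i ` ?D. ?G n \<delta>)"
        using h e by (intro finsum_reindex[symmetric]) auto
      finally show "[((-1 :: int) ^ (i + 1))] \<cdot> (h i \<otimes> e (n - i)) = (\<Oplus>\<delta>\<in>(#) i ` ?D. ?G n \<delta>)" .
    qed (use h e in \<open>auto intro!: finsum_closed\<close>)
    \<comment> \<open>The inner index sets are disjoint for different \<open>i\<close>, which is the
      first part.\<close>
    also have "\<dots> = (\<Oplus>\<delta>\<in>suffix_comps m n. ?G n \<delta>)"
      unfolding suffix_comps_not_dvd[OF False] using h e
      by (intro add.finprod_UN_disjoint[symmetric]) (auto simp: pairwise_def disjnt_def)
    finally show ?thesis .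
  qed
qed

text \<open>The terms of \<open>elementary_expansion_comps\<close> depend only on the type of the
  composition; grouping by type produces the multiplicity \<open>cm_num\<close>.\<close>

lemma elementary_expansion:
  assumes "0 < m" and h: "\<And>i. h i \<in> carrier R" and e: "\<And>i. e i \<in> carrier R" and "h 0 = \<one>"
    and "\<And>d. \<not> m dvd d \<Longrightarrow> (\<Oplus>i\<in>{0..d}. [((-1 :: int) ^ i)] \<cdot> (h i \<otimes> e (d - i))) = \<zero>"
  shows "e n = (\<Oplus>p\<in>exp_index m n.
    [(eps (fst p) * int (cm_num m (fst p)))] \<cdot> (mono_prod R h (fst p) \<otimes> e (snd p * m)))"
proof -
  let ?G = "\<lambda>\<delta>. [eps \<delta>] \<cdot> (mono_prod R h \<delta> \<otimes> e (n - sum_list \<delta>))"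
  let ?D = "\<lambda>p. {\<delta> \<in> suffix_comps m n. mset \<delta> = mset (fst p)}"
  have G: "?G \<delta> \<in> carrier R" for \<delta> using h e by simp
  have "suffix_comps m n = (\<Union>p\<in>exp_index m n. ?D p)"
  proof (intro equalityI subsetI)
    fix \<delta> assume \<delta>: "\<delta> \<in> suffix_comps m n"
    have "sum_list (rev (sort \<delta>)) = sum_list \<delta>" by (metis mset_rev mset_sort sum_mset_sum_list)
    then have "(rev (sort \<delta>), (n - sum_list \<delta>) div m) \<in> exp_index m n"
      using \<delta> is_partition_rev_sort by (auto simp: exp_index_def suffix_comps_def)
    then show "\<delta> \<in> (\<Union>p\<in>exp_index m n. ?D p)" using \<delta> by force
  qed auto
  moreover have disj: "disjnt (?D p) (?D p')"
    if "p \<in> exp_index m n" "p' \<in> exp_index m n" "p \<noteq> p'" for p p'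
  proof -
    have "p = p'" if "mset (fst p) = mset (fst p')"
    proof -
      have "fst p = fst p'"
        using rev_sort_eq_iff[of "fst p" "fst p"] rev_sort_eq_iff[of "fst p'" "fst p"] that
          \<open>p \<in> _\<close> \<open>p' \<in> _\<close> by (auto simp: exp_index_def)
      then show "p = p'"
        using \<open>p \<in> _\<close> \<open>p' \<in> _\<close> \<open>0 < m\<close> by (auto simp: exp_index_def)
    qed
    then show ?thesis using \<open>p \<noteq> p'\<close> by (auto simp: disjnt_def)
  qed
  ultimately have "e n = (\<Oplus>\<delta>\<in>(\<Union>p\<in>exp_index m n. ?D p). ?G \<delta>)"
    using elementary_expansion_comps[of h e m n] assms by simp
  also have "\<dots> = (\<Oplus>p\<in>exp_index m n. \<Oplus>\<delta>\<in>?D p. ?G \<delta>)"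
    using G disj \<open>0 < m\<close> by (intro add.finprod_UN_disjoint) (auto simp: pairwise_def)
  also have "\<dots> = (\<Oplus>p\<in>exp_index m n.
    [(eps (fst p) * int (cm_num m (fst p)))] \<cdot> (mono_prod R h (fst p) \<otimes> e (snd p * m)))"
  proof (intro finsum_cong' refl)
    fix p assume p: "p \<in> exp_index m n"
    let ?x = "mono_prod R h (fst p) \<otimes> e (snd p * m)"
    have "(\<Oplus>\<delta>\<in>?D p. ?G \<delta>) = (\<Oplus>\<delta>\<in>?D p. [eps (fst p)] \<cdot> ?x)"
    proof (intro finsum_cong' refl)
      fix \<delta> assume "\<delta> \<in> ?D p"
      then have mset: "mset \<delta> = mset (fst p)" by simp
      then have "sum_list \<delta> = sum_list (fst p)" by (metis sum_mset_sum_list)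
      then have "n - sum_list \<delta> = snd p * m" using p by (auto simp: exp_index_def)
      then show "?G \<delta> = [eps (fst p)] \<cdot> ?x"
        using mono_prod_mset_cong[OF h mset] eps_mset_cong[OF mset] by simp
    qed (use h e in auto)
    also have "\<dots> = [int (card (?D p))] \<cdot> ([eps (fst p)] \<cdot> ?x)"
      using h e by (simp add: add.finprod_const add_pow_int_ge)
    also have "\<dots> = [(eps (fst p) * int (cm_num m (fst p)))] \<cdot> ?x"
      using h e card_suffix_comps_of_type[OF p] by (simp add: add.int_pow_pow mult.commute)
    finally show "(\<Oplus>\<delta>\<in>?D p. ?G \<delta>) = [(eps (fst p) * int (cm_num m (fst p)))] \<cdot> ?x" .
  qed (use h e in auto)
  finally show ?thesis .
qed

end

section \<open>Transfer along ring homomorphisms and the expansion in \<Gamma>\<close>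

lemma (in ring_hom_cring) hom_add_pow_int:
  assumes "x \<in> carrier R"
  shows "h ([(k :: int)] \<cdot>\<^bsub>R\<^esub> x) = [k] \<cdot>\<^bsub>S\<^esub> h x"
proof -
  have "h \<in> hom (add_monoid R) (add_monoid S)" by (auto simp: hom_def)
  then interpret add_hom: group_hom "add_monoid R" "add_monoid S" h
    by (intro group_hom.intro group_hom_axioms.intro R.a_group S.a_group)
  show ?thesis using add_hom.hom_int_pow[of x k] assms by (simp add: add_pow_def)
qed

lemma (in ring_hom_cring) hom_mono_prod:
  assumes "\<And>i. f i \<in> carrier R"
  shows "h (mono_prod R f \<delta>) = mono_prod S (\<lambda>i. h (f i)) \<delta>"
  using assms by (induction \<delta>) auto

text \<open>This serves both for the projection onto \<Gamma> and for evaluation at a complex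
  point.\<close>

lemma (in ring_hom_cring) hom_expansion:
  assumes "\<And>i. f i \<in> carrier R" "\<And>i. g i \<in> carrier R"
  shows "h (\<Oplus>\<^bsub>R\<^esub>p\<in>A. [(d (fst p) :: int)] \<cdot>\<^bsub>R\<^esub> (mono_prod R f (fst p) \<otimes>\<^bsub>R\<^esub> g (snd p * m))) =
    (\<Oplus>\<^bsub>S\<^esub>p\<in>A. [(d (fst p))] \<cdot>\<^bsub>S\<^esub>
       (mono_prod S (\<lambda>i. h (f i)) (fst p) \<otimes>\<^bsub>S\<^esub> h (g (snd p * m))))"
  using assms by (simp add: comp_def hom_add_pow_int hom_mono_prod)

lemma (in cring) finprod_nth_eq_mono_prod:
  assumes "\<And>i. h i \<in> carrier R"
  shows "(\<Otimes>k\<in>{..<length \<alpha>}. h (\<alpha> ! k)) = mono_prod R h \<alpha>"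
proof (induction \<alpha>)
  case (Cons i \<alpha>)
  have "(\<Otimes>k\<in>{..<length (i # \<alpha>)}. h ((i # \<alpha>) ! k)) =
    h i \<otimes> (\<Otimes>k\<in>Suc ` {..<length \<alpha>}. h ((i # \<alpha>) ! k))"
    using assms by (simp add: lessThan_Suc_eq_insert_0)
  also have "(\<Otimes>k\<in>Suc ` {..<length \<alpha>}. h ((i # \<alpha>) ! k)) = (\<Otimes>k\<in>{..<length \<alpha>}. h (\<alpha> ! k))"
    using assms by (subst finprod_reindex) auto
  finally show ?case using Cons.IH by simp
qed simp

interpretation sym: cring sym_XY
  by (rule cring_sym_XY)

lemma Gamma_rel_carrier: "Gamma_rel d \<in> carrier sym_XY"
  unfolding Gamma_rel_def by (intro sym.finsum_closed) auto

lemma ideal_Gamma_ideal: "ideal (Gamma_ideal m) sym_XY"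
  unfolding Gamma_ideal_def by (intro sym.genideal_ideal) (auto intro: Gamma_rel_carrier)

lemma Gamma_rel_in_ideal: "0 < d \<Longrightarrow> \<not> m dvd d \<Longrightarrow> Gamma_rel d \<in> Gamma_ideal m"
  unfolding Gamma_ideal_def using Gamma_rel_carrier
  by (intro subsetD[OF sym.genideal_self]) auto

lemma cring_Gamma: "cring (Gamma m)"
  unfolding Gamma_def by (intro ideal.quotient_is_cring ideal_Gamma_ideal cring_sym_XY)

abbreviation coset :: "nat \<Rightarrow> var pseries \<Rightarrow> var pseries set" where
  "coset m f \<equiv> Gamma_ideal m +>\<^bsub>sym_XY\<^esub> f"

lemma coset_hom: "ring_hom_cring sym_XY (Gamma m) (coset m)"
  unfolding Gamma_def by (intro ideal.rcos_ring_hom_cring ideal_Gamma_ideal cring_sym_XY)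

lemma h_img_closed [simp]: "h_img m i \<in> carrier (Gamma m)"
  unfolding h_img_def using ring_hom_cring.homh[OF coset_hom] by (rule ring_hom_closed) simp

lemma e_img_closed [simp]: "e_img m i \<in> carrier (Gamma m)"
  unfolding e_img_def using ring_hom_cring.homh[OF coset_hom] by (rule ring_hom_closed) simp

lemma complete_sym_0: "complete_sym V 0 = \<one>\<^bsub>sym_XY\<^esub>"
  by (auto simp: complete_sym_def sym_XY_simps fun_eq_iff)

lemma h_prod_eq: "h_prod m \<alpha> = mono_prod (Gamma m) (h_img m) \<alpha>"
  unfolding h_prod_def by (rule cring.finprod_nth_eq_mono_prod[OF cring_Gamma]) simp

lemma zero_Gamma: "\<zero>\<^bsub>Gamma m\<^esub> = Gamma_ideal m"
  by (simp add: Gamma_def FactRing_def)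

lemma e_img_expansion:
  assumes "0 < m"
  shows "e_img m n = (\<Oplus>\<^bsub>Gamma m\<^esub>p\<in>exp_index m n.
    [(eps (fst p) * int (cm_num m (fst p)))] \<cdot>\<^bsub>Gamma m\<^esub>
      (h_prod m (fst p) \<otimes>\<^bsub>Gamma m\<^esub> e_img m (snd p * m)))"
  unfolding h_prod_eq
proof (rule cring.elementary_expansion[OF cring_Gamma assms])
  interpret coset: ring_hom_cring sym_XY "Gamma m" "coset m" by (rule coset_hom)
  show "h_img m 0 = \<one>\<^bsub>Gamma m\<^esub>"
    by (simp add: h_img_def complete_sym_0)
  fix d assume "\<not> m dvd d"
  \<comment> \<open>The index d = 0, where no relation is imposed, cannot occur because
    \<open>m\<close> divides 0.\<close>
  then have "Gamma_rel d \<in> Gamma_ideal m" by (intro Gamma_rel_in_ideal) (auto intro: Nat.gr0I)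
  then have "coset m (Gamma_rel d) = \<zero>\<^bsub>Gamma m\<^esub>"
    unfolding zero_Gamma by (rule sym.a_rcos_zero[OF ideal_Gamma_ideal])
  then show "(\<Oplus>\<^bsub>Gamma m\<^esub>i\<in>{0..d}. [((-1 :: int) ^ i)] \<cdot>\<^bsub>Gamma m\<^esub>
      (h_img m i \<otimes>\<^bsub>Gamma m\<^esub> e_img m (d - i))) = \<zero>\<^bsub>Gamma m\<^esub>"
    by (simp add: comp_def Gamma_rel_def h_img_def e_img_def coset.hom_add_pow_int)
qed simp_all

section \<open>Uniqueness of the expansion\<close>

interpretation complex: cring complex_ring
  by (rule cring_complex_ring)

lemma complex_ring_finsum: "finite A \<Longrightarrow> finsum complex_ring f A = sum f A"
  by (induction A rule: finite_induct) auto

lemma complex_ring_add_pow: "[(k :: int)] \<cdot>\<^bsub>complex_ring\<^esub> x = of_int k * x"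
proof -
  have nat: "[(n :: nat)] \<cdot>\<^bsub>complex_ring\<^esub> x = of_nat n * x" for n
    by (induction n) (simp_all add: distrib_right)
  have inv: "\<ominus>\<^bsub>complex_ring\<^esub> y = - y" for y
    by (rule complex.minus_equality) auto
  show ?thesis
    by (cases "0 \<le> k") (simp_all add: add_pow_int_ge add_pow_int_lt nat inv)
qed

lemma complex_ring_mono_prod: "mono_prod complex_ring h \<delta> = prod_list (map h \<delta>)"
  by (induction \<delta>) auto

section \<open>Multiplicities as digits in base B\<close>

lemma digits_less:
  fixes c :: "nat \<Rightarrow> nat"
  assumes "\<And>k. c k < B"
  shows "(\<Sum>k<K. c k * B ^ k) < B ^ K"
proof (induction K)
  case (Suc K)
  have "Suc (c K) * B ^ K \<le> B * B ^ K"
    using assms[of K] by (intro mult_le_mono1) simp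
  then show ?case using Suc by simp
qed simp

text \<open>Division by B ^ K isolates the top digit, because the lower digits sum to less than B ^
  K.\<close>

lemma digits_unique:
  fixes c c' :: "nat \<Rightarrow> nat"
  assumes "\<And>k. c k < B" "\<And>k. c' k < B" "(\<Sum>k<K. c k * B ^ k) = (\<Sum>k<K. c' k * B ^ k)" "k < K"
  shows "c k = c' k"
  using assms(3,4)
proof (induction K)
  case (Suc K)
  have "0 < B" using assms(1)[of 0] by linarith
  then have "0 < B ^ K" by simp
  have div: "((\<Sum>k<Suc K. f k * B ^ k) div B ^ K = f K)" if "\<And>k. f k < B" for f :: "nat \<Rightarrow> nat"
    using digits_less[where c = f and K = K, OF that] \<open>0 < B ^ K\<close> by simp
  have "c K = c' K" using div[where f = c, OF assms(1)] div[where f = c', OF assms(2)] Suc.prems(1) by simp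
  then show ?case using Suc by (cases "k = K") auto
qed simp

text \<open>The digits of the weight in base \<open>B\<close> are the multiplicities of the entries,
  which are at most the length and hence below \<open>B\<close>.\<close>

lemma mset_eq_if_weight_eq:
  fixes \<mu> \<nu> :: "nat list"
  assumes "length \<mu> < B" "length \<nu> < B" "(\<Sum>k\<leftarrow>\<mu>. B ^ k) = (\<Sum>k\<leftarrow>\<nu>. B ^ k)"
  shows "mset \<mu> = mset \<nu>"
proof -
  define K where "K = Suc (Max (insert 0 (set \<mu> \<union> set \<nu>)))"
  have K: "k < K" if "k \<in> set \<mu> \<union> set \<nu>" for k
    using that unfolding K_def by (intro le_imp_less_Suc Max_ge) auto
  have sum: "(\<Sum>k\<leftarrow>\<alpha>. B ^ k) = (\<Sum>k<K. count (mset \<alpha>) k * B ^ k)" if "set \<alpha> \<subseteq> {..<K}" for \<alpha>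
    using sum_list_map_eq_sum_count2[OF that, of "\<lambda>k. B ^ k"] by (simp add: count_mset)
  have less: "count (mset \<alpha>) k < B" if "length \<alpha> < B" for \<alpha> :: "nat list" and k
    using that count_le_size[of "mset \<alpha>" k] by simp
  have "count (mset \<mu>) k = count (mset \<nu>) k" for k
  proof (cases "k < K")
    case True
    have "set \<mu> \<subseteq> {..<K}" "set \<nu> \<subseteq> {..<K}" using K by auto
    then have "(\<Sum>k<K. count (mset \<mu>) k * B ^ k) = (\<Sum>k<K. count (mset \<nu>) k * B ^ k)"
      using assms(3) sum by metis
    then show ?thesis
      using digits_unique[where c = "count (mset \<mu>)" and c' = "count (mset \<nu>)" and B = B and K = K]
        less assms(1,2) True by blast
  next
    case False
    then have "k \<notin> set \<mu>" "k \<notin> set \<nu>" using K by auto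
    then show ?thesis by (metis count_mset_0_iff)
  qed
  then show ?thesis by (simp add: multiset_eq_iff)
qed

text \<open>The kernel of the evaluation is an ideal containing the generators of
  \<open>Gamma_ideal m\<close>, so evaluation factors through \<Gamma>.\<close>

lemma coset_eq_imp_eval_eq:
  assumes "finite F" "f \<in> carrier sym_XY" "g \<in> carrier sym_XY" "coset m f = coset m g"
    and rel: "\<And>d. \<not> m dvd d \<Longrightarrow> (\<Sum>i\<le>d. (-1) ^ i *
       (pseries_eval F a (complete_sym Xvars i) * pseries_eval F a (elem_sym Yvars (d - i)))) = 0"
  shows "pseries_eval F a f = pseries_eval F a g"
proof -
  let ?ev = "pseries_eval F a"
  interpret ev: ring_hom_cring sym_XY complex_ring ?ev
    using pseries_eval_hom[OF assms(1)] by unfold_locales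
  have ring_hom: "ring_hom_ring sym_XY complex_ring ?ev"
    by (intro ring_hom_ringI2 sym.ring_axioms complex.ring_axioms ev.homh)
  have "Gamma_ideal m \<subseteq> a_kernel sym_XY complex_ring ?ev"
    unfolding Gamma_ideal_def
  proof (rule sym.genideal_minimal[OF ring_hom_ring.kernel_is_ideal[OF ring_hom]], safe)
    fix d assume "\<not> m dvd d"
    have "?ev (Gamma_rel d) = 0"
      using rel[OF \<open>\<not> m dvd d\<close>]
      by (simp add: comp_def Gamma_rel_def ev.hom_add_pow_int complex_ring_finsum complex_ring_add_pow atLeast0AtMost)
    then show "Gamma_rel d \<in> a_kernel sym_XY complex_ring ?ev"
      unfolding a_kernel_def' using Gamma_rel_carrier by (simp only: mem_Collect_eq complex_ring_simps simp_thms)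
  qed
  moreover have "f \<ominus>\<^bsub>sym_XY\<^esub> g \<in> Gamma_ideal m"
    using sym.quotient_eq_iff_same_a_r_cos[OF ideal_Gamma_ideal] assms by blast
  ultimately have "?ev (f \<ominus>\<^bsub>sym_XY\<^esub> g) = 0"
    unfolding a_kernel_def' complex_ring_simps by blast
  moreover have "?ev f = ?ev (f \<ominus>\<^bsub>sym_XY\<^esub> g) + ?ev g"
    using assms(2,3) ev.hom_add[of "f \<ominus>\<^bsub>sym_XY\<^esub> g" g]
    by (simp add: sym.minus_eq sym.a_assoc sym.l_neg)
  ultimately show ?thesis by simp
qed

text \<open>Both expansions lift to \<open>sym_XY\<close>. Evaluation there yields an identity
  between two polynomials in T, valid for all complex T, whose exponents tell the indices
  apart.\<close>

lemma expansion_unique: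
  fixes d d' :: "nat list \<Rightarrow> int"
  defines "X \<equiv> \<lambda>m n d. (\<Oplus>\<^bsub>Gamma m\<^esub>p\<in>exp_index m n. [(d (fst p))] \<cdot>\<^bsub>Gamma m\<^esub>
      (h_prod m (fst p) \<otimes>\<^bsub>Gamma m\<^esub> e_img m (snd p * m)))"
  assumes "0 < m" "X m n d = X m n d'" "p \<in> exp_index m n"
  shows "d (fst p) = d' (fst p)"
proof -
  let ?I = "exp_index m n"
  have fin: "finite ?I" using assms(2) by simp
  let ?L = "\<lambda>d :: nat list \<Rightarrow> int. (\<Oplus>\<^bsub>sym_XY\<^esub>p\<in>?I. [(d (fst p))] \<cdot>\<^bsub>sym_XY\<^esub>
      (mono_prod sym_XY (complete_sym Xvars) (fst p) \<otimes>\<^bsub>sym_XY\<^esub> elem_sym Yvars (snd p * m)))"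
  have L: "?L d \<in> carrier sym_XY" for d
    by (intro sym.finsum_closed) auto
  have "X m n d = coset m (?L d)" for d
    using ring_hom_cring.hom_expansion[OF coset_hom[of m], where f = "complete_sym Xvars" and g = "elem_sym Yvars" and d = d
      and A = ?I and m = m]
    unfolding X_def h_prod_eq by (simp add: h_img_def[abs_def] e_img_def)
  then have coset_eq: "coset m (?L d) = coset m (?L d')" using assms(3) by simp
  \<comment> \<open>This base exceeds the length of every partition of size at most
    \<open>n\<close>.\<close>
  define B where "B = Suc n"
  define wt where "wt = (\<lambda>p :: nat list \<times> nat. \<Sum>k\<leftarrow>fst p. B ^ k)"
  have inj: "p = q" if "p \<in> ?I" "q \<in> ?I" "wt p = wt q" for p q
  proof -
    have len: "length (fst p) < B" if "p \<in> ?I" for p :: "nat list \<times> nat"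
      using that length_le_sum_list[of "fst p"] by (auto simp: B_def exp_index_def is_partition_def)
    have "mset (fst p) = mset (fst q)"
      using that len by (intro mset_eq_if_weight_eq[of _ B]) (auto simp: wt_def)
    then have "fst p = fst q"
      using rev_sort_eq_iff[of "fst p" "fst p"] rev_sort_eq_iff[of "fst q" "fst p"] that
      by (auto simp: exp_index_def)
    then show "p = q" using that \<open>0 < m\<close> by (auto simp: exp_index_def)
  qed
  have eval: "(\<Sum>p\<in>?I. of_int (d (fst p)) * T ^ wt p) = (\<Sum>p\<in>?I. of_int (d' (fst p)) * T ^ wt p)"
    for T :: complex
  proof -
    \<comment> \<open>The exception at 0 is forced by h_0 = 1; partitions have no part 0, so the
      weights are unaffected.\<close>
    define v where "v = (\<lambda>i :: nat. if i = 0 then 1 else T ^ (B ^ i))"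
    obtain F a where F: "finite F"
      and h: "\<And>i. i \<le> n \<Longrightarrow> pseries_eval F a (complete_sym Xvars i) = v i"
      and e: "\<And>s. s * m \<le> n \<Longrightarrow> pseries_eval F a (elem_sym Yvars (s * m)) = 1"
      and rel: "\<And>d. \<not> m dvd d \<Longrightarrow> (\<Sum>i\<le>d. (-1) ^ i *
       (pseries_eval F a (complete_sym Xvars i) * pseries_eval F a (elem_sym Yvars (d - i)))) = 0"
      using evaluation_exists[OF \<open>0 < m\<close>, of v n] by (auto simp: v_def)
    interpret ev: ring_hom_cring sym_XY complex_ring "pseries_eval F a"
      using pseries_eval_hom[OF F] by unfold_locales
    have "pseries_eval F a (?L d) = (\<Sum>p\<in>?I. of_int (d (fst p)) * T ^ wt p)" for d
    proof -
      have "pseries_eval F a (?L d) = (\<Sum>p\<in>?I. of_int (d (fst p)) *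
        (prod_list (map (\<lambda>i. pseries_eval F a (complete_sym Xvars i)) (fst p)) *
         pseries_eval F a (elem_sym Yvars (snd p * m))))"
        using fin by (subst ev.hom_expansion)
          (simp_all add: complex_ring_finsum complex_ring_add_pow complex_ring_mono_prod)
      also have "\<dots> = (\<Sum>p\<in>?I. of_int (d (fst p)) * T ^ wt p)"
      proof (intro sum.cong refl arg_cong2[of _ _ _ _ "(*)"])
        fix p assume p: "p \<in> ?I"
        have "i \<le> n \<and> 0 < i" if "i \<in> set (fst p)" for i
          using p that member_le_sum_list[of i "fst p"]
          by (auto simp: exp_index_def is_partition_def is_composition_def)
        then have vals: "map (\<lambda>i. pseries_eval F a (complete_sym Xvars i)) (fst p) = map (\<lambda>i. T ^ (B ^ i)) (fst p)"
          using h by (auto simp: v_def)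
        have powers: "prod_list (map (\<lambda>i. T ^ (B ^ i)) \<mu>) = T ^ (\<Sum>k\<leftarrow>\<mu>. B ^ k)" for \<mu>
          by (induction \<mu>) (auto simp: power_add)
        have "snd p * m \<le> n" using p by (auto simp: exp_index_def)
        then show "prod_list (map (\<lambda>i. pseries_eval F a (complete_sym Xvars i)) (fst p)) *
          pseries_eval F a (elem_sym Yvars (snd p * m)) = T ^ wt p"
          unfolding vals powers wt_def using e by simp
      qed
      finally show ?thesis .
    qed
    then show ?thesis using coset_eq_imp_eval_eq[OF F L L coset_eq rel] by simp
  qed
  define q :: "complex poly" where "q = (\<Sum>p\<in>?I. monom (of_int (d (fst p) - d' (fst p))) (wt p))"
  have "poly q T = 0" for T
    using eval[of T] by (simp add: q_def poly_sum poly_monom left_diff_distrib sum_subtractf)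
  then have "q = 0" using poly_all_0_iff_0 by blast
  then have "0 = coeff q (wt p)" by simp
  \<comment> \<open>Distinct indices have distinct weights, so a single monomial contributes to this
    coefficient.\<close>
  also have "\<dots> = (\<Sum>p'\<in>?I. if p' = p then of_int (d (fst p') - d' (fst p')) else 0)"
    unfolding q_def coeff_sum using inj assms(4) by (intro sum.cong) (auto simp: coeff_monom)
  also have "\<dots> = of_int (d (fst p) - d' (fst p))" using fin assms(4) by simp
  finally have "(of_int (d (fst p) - d' (fst p)) :: complex) = 0" by simp
  then show ?thesis by (simp only: of_int_eq_0_iff)
qed

section \<open>The coefficients of e_n and the theorem\<close>

lemma e_coeffs_eq:
  assumes "0 < m"
  shows "e_coeffs m n =
    (\<lambda>\<mu>. if \<mu> \<in> fst ` exp_index m n then eps \<mu> * int (cm_num m \<mu>) else 0)" (is "_ = ?d")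
  unfolding e_coeffs_def
proof (rule the_equality)
  interpret cring "Gamma m" by (rule cring_Gamma)
  have "e_img m n = (\<Oplus>\<^bsub>Gamma m\<^esub>p\<in>exp_index m n. [(?d (fst p))] \<cdot>\<^bsub>Gamma m\<^esub>
      (h_prod m (fst p) \<otimes>\<^bsub>Gamma m\<^esub> e_img m (snd p * m)))"
    by (subst e_img_expansion[OF assms], rule finsum_cong') (auto simp: h_prod_eq)
  then show *: "(\<forall>\<mu>. \<mu> \<notin> fst ` exp_index m n \<longrightarrow> ?d \<mu> = 0) \<and>
    e_img m n = (\<Oplus>\<^bsub>Gamma m\<^esub>p\<in>exp_index m n. [(?d (fst p))] \<cdot>\<^bsub>Gamma m\<^esub>
      (h_prod m (fst p) \<otimes>\<^bsub>Gamma m\<^esub> e_img m (snd p * m)))"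
    by simp
  fix d :: "nat list \<Rightarrow> int"
  assume d: "(\<forall>\<mu>. \<mu> \<notin> fst ` exp_index m n \<longrightarrow> d \<mu> = 0) \<and>
    e_img m n = (\<Oplus>\<^bsub>Gamma m\<^esub>p\<in>exp_index m n. [(d (fst p))] \<cdot>\<^bsub>Gamma m\<^esub>
      (h_prod m (fst p) \<otimes>\<^bsub>Gamma m\<^esub> e_img m (snd p * m)))"
  show "d = ?d"
  proof
    fix \<mu> show "d \<mu> = ?d \<mu>"
    proof (cases "\<mu> \<in> fst ` exp_index m n")
      case True
      then obtain p where "p \<in> exp_index m n" "\<mu> = fst p" by blast
      moreover have "(\<Oplus>\<^bsub>Gamma m\<^esub>p\<in>exp_index m n. [(d (fst p))] \<cdot>\<^bsub>Gamma m\<^esub>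
          (h_prod m (fst p) \<otimes>\<^bsub>Gamma m\<^esub> e_img m (snd p * m))) =
        (\<Oplus>\<^bsub>Gamma m\<^esub>p\<in>exp_index m n. [(?d (fst p))] \<cdot>\<^bsub>Gamma m\<^esub>
          (h_prod m (fst p) \<otimes>\<^bsub>Gamma m\<^esub> e_img m (snd p * m)))"
        by (rule trans[OF sym[OF conjunct2[OF d]] conjunct2[OF *]])
      ultimately show ?thesis using expansion_unique[OF assms, where d = d and d' = ?d and n = n and p = p] by blast
    next
      \<comment> \<open>Outside the index set the expansion says nothing; there both functions are 0
        by the first clause of \<open>e_coeffs\<close>.\<close>
      case False
      then show ?thesis using d by simp
    qed
  qed
qed

lemma d_num_eq:
  assumes "0 < m" "is_partition \<mu>"
  shows "d_num m \<mu> = eps \<mu> * int (cm_num m \<mu>)"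
proof -
  have "\<mu> \<in> fst ` exp_index m (sum_list \<mu> + r * m)" for r
    using assms(2) by (intro image_eqI[of _ _ "(\<mu>, r)"]) (auto simp: exp_index_def)
  \<comment> \<open>The formula for the coefficient does not mention \<open>r\<close>, which proves
    the independence required by \<open>d_num\<close>.\<close>
  then have "e_coeffs m (sum_list \<mu> + r * m) \<mu> = eps \<mu> * int (cm_num m \<mu>)" for r
    by (simp add: e_coeffs_eq[OF assms(1)])
  then show ?thesis unfolding d_num_def by (intro the_equality) auto
qed

theorem lemma4p5:
  fixes m n b :: nat and lam :: "nat list"
  assumes "0 < m"
    and "is_partition lam" and "sum_list lam = n"
    and "b = n div m"
  shows "(\<forall>j\<in>{1..b}.
            (\<Sum>S | S \<subseteq> {1..b} \<and> card S = j. card (\<Inter>i\<in>S. P_set m lam i))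
            = (\<Sum>A\<in>W_len m j lam. c_seq A))
         \<and> d_num m lam = eps lam * int (cm_num m lam)"
proof (intro conjI ballI)
  fix j assume "j \<in> {1..b}"
  then have "0 < j" by simp
  then show "(\<Sum>S | S \<subseteq> {1..b} \<and> card S = j. card (\<Inter>i\<in>S. P_set m lam i)) =
    (\<Sum>A\<in>W_len m j lam. c_seq A)"
    unfolding assms(4) assms(3)[symmetric] by (rule sum_card_Inter_P_set_eq_sum_c_seq[OF assms(1,2)])
qed (use assms d_num_eq in blast)

end
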